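(* Let $d,n,d_1,\ldots,d_n$ be positive integers with $n>d$. Let $\mathcal{F}=\{X_1,\ldots,X_n\}$ be a matrix frame with $X_i\in\mathbb{R}^{d\times d_i}$ for $i\in[n]$, and let $\mathbf{c}=(c_1,\ldots,c_n)\in\mathbb{Q}_{>0}^n$ be positive rational weights such that $\sum_{i=1}^n c_i=d$. Then the following statements hold. (1) The domain of $f_{\mathcal{F}}|_{\mathbb{Q}_{>0}^n}$, i.e. the set of $\mathbf{b}\in\mathbb{Q}^n_{>0}$ for which $f_{\mathcal{F}}(\mathbf{b})$ is finite, is precisely $K_{\mathcal{F}}\cap\mathbb{Q}_{>0}^n$. (2) Assume that $(\mathcal{F},\mathbf{c})$ is a semi-stable matrix frame. Then $(\mathcal{F},\mathbf{c})$ degenerates (in the sense of quiver representations) to a semi-stable matrix frame $(\widetilde{\mathcal{F}},\mathbf{c})$ such that $(\widetilde{\mathcal{F}},\mathbf{c})$ can be transformed into a radial isotropic matrix frame (RIF). (3) Assume that $V_{\mathcal{F}}$ is a locally semi-simple representation. Then the following statements are equivalent: (i) $\mathbf{c}$ lies in the relative interior of $K_{\mathcal{F}}$; (ii) $(\mathcal{F},\mathbf{c})$ can be transformed into a RIF; (iii) $f_{\mathcal{F}}(\mathbf{c})$ is finite and the infimum defining it is attained at some point of $\mathbb{R}^n$.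
   Context: Notation: $[n]=\{1,\ldots,n\}$; $\operatorname{Col}(X)$ is the column space of a matrix $X$; $\|\cdot\|_F$ is the Frobenius norm; $\langle\cdot,\cdot\rangle$ is the standard inner product. Matrix frames. A tuple $\mathcal{F}=\{X_1,\ldots,X_n\}$ with $X_i\in\mathbb{R}^{d\times d_i}$ is a matrix frame if $\sum_{i=1}^n X_iX_i^T$ is positive definite. Its orbit polytope is $$K_{\mathcal{F}}=\Big\{\mathbf{c}\in\mathbb{R}^n_{\ge 0} : \sum_{i=1}^n c_i=d,\ \sum_{i\in I}c_i\le\dim\Big(\sum_{i\in I}\operatorname{Col}(X_i)\Big)\ \forall I\subseteq[n]\Big\}.$$ For $\mathbf{c}\in\mathbb{Q}^n_{>0}$: $(\mathcal{F},\mathbf{c})$ is a semi-stable matrix frame if $\mathbf{c}\in K_{\mathcal{F}}$. $(\mathcal{F},\mathbf{c})$ is a radial isotropic matrix frame (RIF) if all $X_i\ne0$ and $\sum_{i=1}^n c_i\frac{X_iX_i^T}{\|X_i\|_F^2}=I_d$. $(\mathcal{F},\mathbf{c})$ can be transformed into a RIF if there is $A\in\mathrm{GL}(d,\mathbb{R})$ such that $(\{AX_i\}_{i\in[n]},\mathbf{c})$ is a RIF. The function $f_{\mathcal{F}}$. For $t\in\mathbb{R}^n$ put $\Phi_{\mathcal{F}}(t)=\log\det\left(\sum_{i=1}^n e^{t_i}X_iX_i^T\right)$, and define $f_{\mathcal{F}}:\mathbb{R}^n\to\mathbb{R}\cup\{-\infty\}$ by $f_{\mathcal{F}}(\mathbf{c})=\inf_{t\in\mathbb{R}^n}\{\Phi_{\mathcal{F}}(t)-\langle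 t,\mathbf{c}\rangle\}$. The quiver and the representation $V_{\mathcal{F}}$. Let $\mathcal{Q}$ be the quiver with vertices $0,1,\ldots,n$ and, for each $i\in[n]$, exactly $d_i$ arrows $a_{i,1},\ldots,a_{i,d_i}$ from $0$ to $i$. A real representation $V$ of a quiver assigns a finite-dimensional real vector space $V(x)$ to each vertex $x$ and a linear map $V(a):V(ta)\to V(ha)$ to each arrow $a$ with tail $ta$ and head $ha$; a subrepresentation $W\subseteq V$ consists of subspaces $W(x)\subseteq V(x)$ with $V(a)(W(ta))\subseteq W(ha)$ for all arrows $a$, with the restricted maps. The representation $V_{\mathcal{F}}$ of $\mathcal{Q}$ has $V_{\mathcal{F}}(0)=\mathbb{R}^d$, $V_{\mathcal{F}}(i)=\mathbb{R}$ for $i\in[n]$, and $V_{\mathcal{F}}(a_{i,\ell})=\mathbf{x}_{i,\ell}^T$, where $\mathbf{x}_{i,\ell}\in\mathbb{R}^d$ is the $\ell$th column of $X_i$. Stability. For a weight $\sigma\in\mathbb{R}^{\mathcal{Q}_0}$ ($\mathcal{Q}_0$ is the vertex set), write $\sigma\cdot\operatorname{\mathbf{dim}}V=\sum_x\sigma(x)\dim V(x)$. $V$ is $\sigma$-semi-stable if $\sigma\cdot\operatorname{\mathbf{dim}}V=0$ and $\sigma\cdot\operatorname{\mathbf{dim}}V'\le0$ for all subrepresentations $V'\subseteq V$; it is $\sigma$-stable if $\sigma\cdot\operatorname{\mathbf{dim}}V=0$ and the inequality is strict for all $0\ne V'\subsetneq V$; it is $\sigma$-polystable if it is a finite direct sum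 of $\sigma$-stable representations. $V$ is locally semi-simple if it is $\sigma_0$-polystable for some integral weight $\sigma_0\in\mathbb{Z}^{\mathcal{Q}_0}$. Degeneration. The group $\mathrm{GL}(d,\mathbb{R})\times(\mathbb{R}^\times)^n$ acts on the space of representations of $\mathcal{Q}$ with $\mathbb{R}^d$ at vertex $0$ and $\mathbb{R}$ at each vertex $i\in[n]$ by $((A_0,\lambda_1,\ldots,\lambda_n)\cdot V)(a_{i,\ell})=\lambda_iV(a_{i,\ell})A_0^{-1}$. $(\mathcal{F},\mathbf{c})$ degenerates to $(\widetilde{\mathcal{F}},\mathbf{c})$, where $\widetilde{\mathcal{F}}=\{\widetilde X_1,\ldots,\widetilde X_n\}$ with $\widetilde X_i\in\mathbb{R}^{d\times d_i}$, if $V_{\widetilde{\mathcal{F}}}$ lies in the (Euclidean) closure of the orbit of $V_{\mathcal{F}}$ under this group. *)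

theory Defs
  imports
    "HOL-Analysis.Analysis"
    "HOL-Library.Set_Algebras"
    "Graph_Theory.Digraph"
begin

section \<open>Matrix frames\<close>

text \<open>
  A tuple \<open>(X\<^sub>i)\<close> of real matrices with \<open>d = CARD('d)\<close> rows, indexed by \<open>[n]\<close> with
  \<open>n = CARD('n)\<close>, in which the number \<open>d\<^sub>i\<close> of columns may depend on \<open>i\<close>. The columns of \<open>X\<^sub>i\<close> are
  indexed by the set \<open>J i\<close> of a common finite index type, so \<open>d\<^sub>i = card (J i)\<close>, and the columns
  outside \<open>J i\<close> are zero. This padding affects neither \<open>X\<^sub>i X\<^sub>i\<^sup>T\<close>, nor the Frobenius norm, nor the
  column space, nor \<open>A X\<^sub>i\<close>.
\<close>

type_synonym ('d, 'k, 'n) matrix_tuple = "(real ^ 'k ^ 'd) ^ 'n"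

definition has_columns ::
    "('n::finite \<Rightarrow> 'k::finite set) \<Rightarrow> ('d::finite, 'k, 'n) matrix_tuple \<Rightarrow> bool" where
  "has_columns J F \<longleftrightarrow> (\<forall>i l. l \<notin> J i \<longrightarrow> column l (F $ i) = 0)"

definition positive_definite :: "real ^ 'd::finite ^ 'd \<Rightarrow> bool" where
  "positive_definite M \<longleftrightarrow> transpose M = M \<and> (\<forall>v. v \<noteq> 0 \<longrightarrow> v \<bullet> (M *v v) > 0)"

definition matrix_frame ::
    "('n::finite \<Rightarrow> 'k::finite set) \<Rightarrow> ('d::finite, 'k, 'n) matrix_tuple \<Rightarrow> bool" where
  "matrix_frame J F \<longleftrightarrow>
     has_columns J F \<and> positive_definite (\<Sum>i\<in>UNIV. F $ i ** transpose (F $ i))"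

abbreviation Col :: "real ^ 'k::finite ^ 'd::finite \<Rightarrow> (real ^ 'd) set" where
  "Col X \<equiv> span (columns X)"

text \<open>The sum of column spaces below is the sum of subspaces (Minkowski sum of sets).\<close>

definition orbit_polytope ::
    "('d::finite, 'k::finite, 'n::finite) matrix_tuple \<Rightarrow> (real ^ 'n) set" where
  "orbit_polytope F =
     {c. (\<forall>i. 0 \<le> c $ i) \<and> (\<Sum>i\<in>UNIV. c $ i) = real CARD('d) \<and>
         (\<forall>I. (\<Sum>i\<in>I. c $ i) \<le> real (dim (\<Sum>i\<in>I. Col (F $ i))))}"

definition pos_rat_vectors :: "(real ^ 'n::finite) set" where
  "pos_rat_vectors = {c. \<forall>i. c $ i \<in> \<rat> \<and> 0 < c $ i}"

definition semi_stable_frame ::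
    "('n::finite \<Rightarrow> 'k::finite set) \<Rightarrow> ('d::finite, 'k, 'n) matrix_tuple \<Rightarrow> real ^ 'n \<Rightarrow> bool" where
  "semi_stable_frame J F c \<longleftrightarrow>
     matrix_frame J F \<and> c \<in> pos_rat_vectors \<and> c \<in> orbit_polytope F"

text \<open>The norm of the type \<^typ>\<open>real ^ 'k ^ 'd\<close> is the Frobenius norm.\<close>

definition radial_isotropic ::
    "('d::finite, 'k::finite, 'n::finite) matrix_tuple \<Rightarrow> real ^ 'n \<Rightarrow> bool" where
  "radial_isotropic F c \<longleftrightarrow>
     (\<forall>i. F $ i \<noteq> 0) \<and>
     (\<Sum>i\<in>UNIV. (c $ i / (norm (F $ i))\<^sup>2) *\<^sub>R (F $ i ** transpose (F $ i))) = mat 1"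

definition transformable_to_RIF ::
    "('d::finite, 'k::finite, 'n::finite) matrix_tuple \<Rightarrow> real ^ 'n \<Rightarrow> bool" where
  "transformable_to_RIF F c \<longleftrightarrow>
     (\<exists>A :: real ^ 'd ^ 'd. invertible A \<and> radial_isotropic (\<chi> i. A ** F $ i) c)"

definition Phi ::
    "('d::finite, 'k::finite, 'n::finite) matrix_tuple \<Rightarrow> real ^ 'n \<Rightarrow> real" where
  "Phi F t = ln (det (\<Sum>i\<in>UNIV. exp (t $ i) *\<^sub>R (F $ i ** transpose (F $ i))))"

definition f_frame ::
    "('d::finite, 'k::finite, 'n::finite) matrix_tuple \<Rightarrow> real ^ 'n \<Rightarrow> ereal" where
  "f_frame F c = (INF t. ereal (Phi F t - t \<bullet> c))"


section \<open>Quiver representations\<close>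

text \<open>
  A quiver is a \<^typ>\<open>('v, 'a) pre_digraph\<close>. All spaces of a representation are subspaces of one
  ambient Euclidean space; the map attached to an arrow is a linear map of the ambient space, of
  which only the restriction to the space at the tail is relevant.
\<close>

record ('v, 'a, 'e) quiver_rep =
  space_at :: "'v \<Rightarrow> 'e set"
  map_at :: "'a \<Rightarrow> 'e \<Rightarrow> 'e"

definition is_rep ::
    "('v, 'a) pre_digraph \<Rightarrow> ('v, 'a, 'e::euclidean_space) quiver_rep \<Rightarrow> bool" where
  "is_rep Q V \<longleftrightarrow>
     (\<forall>x\<in>verts Q. subspace (space_at V x)) \<and>
     (\<forall>a\<in>arcs Q. linear (map_at V a) \<and>
        map_at V a ` space_at V (tail Q a) \<subseteq> space_at V (head Q a))"

definition subrep ::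
    "('v, 'a) pre_digraph \<Rightarrow> ('v, 'a, 'e::euclidean_space) quiver_rep \<Rightarrow>
     ('v, 'a, 'e) quiver_rep \<Rightarrow> bool" where
  "subrep Q W V \<longleftrightarrow>
     is_rep Q W \<and> (\<forall>x\<in>verts Q. space_at W x \<subseteq> space_at V x) \<and>
     (\<forall>a\<in>arcs Q. \<forall>v\<in>space_at W (tail Q a). map_at W a v = map_at V a v)"

definition weight_dim ::
    "('v, 'a) pre_digraph \<Rightarrow> ('v \<Rightarrow> real) \<Rightarrow> ('v, 'a, 'e::euclidean_space) quiver_rep \<Rightarrow> real" where
  "weight_dim Q \<sigma> V = (\<Sum>x\<in>verts Q. \<sigma> x * real (dim (space_at V x)))"

definition stable_rep ::
    "('v, 'a) pre_digraph \<Rightarrow> ('v \<Rightarrow> real) \<Rightarrow> ('v, 'a, 'e::euclidean_space) quiver_rep \<Rightarrow> bool" where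
  "stable_rep Q \<sigma> V \<longleftrightarrow>
     is_rep Q V \<and> weight_dim Q \<sigma> V = 0 \<and>
     (\<forall>W. subrep Q W V \<and> (\<exists>x\<in>verts Q. space_at W x \<noteq> {0}) \<and>
          (\<exists>x\<in>verts Q. space_at W x \<noteq> space_at V x) \<longrightarrow> weight_dim Q \<sigma> W < 0)"

text \<open>\<open>V\<close> is the internal direct sum of its subrepresentations \<open>W 0, \<dots>, W (m - 1)\<close>.\<close>

definition rep_direct_sum ::
    "('v, 'a) pre_digraph \<Rightarrow> ('v, 'a, 'e::euclidean_space) quiver_rep \<Rightarrow> nat \<Rightarrow>
     (nat \<Rightarrow> ('v, 'a, 'e) quiver_rep) \<Rightarrow> bool" where
  "rep_direct_sum Q V m W \<longleftrightarrow>
     is_rep Q V \<and> (\<forall>j<m. subrep Q (W j) V) \<and>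
     (\<forall>x\<in>verts Q.
        space_at V x = (\<Sum>j<m. space_at (W j) x) \<and>
        (\<forall>v. (\<forall>j<m. v j \<in> space_at (W j) x) \<and> (\<Sum>j<m. v j) = 0 \<longrightarrow> (\<forall>j<m. v j = 0)))"

definition polystable_rep ::
    "('v, 'a) pre_digraph \<Rightarrow> ('v \<Rightarrow> real) \<Rightarrow> ('v, 'a, 'e::euclidean_space) quiver_rep \<Rightarrow> bool" where
  "polystable_rep Q \<sigma> V \<longleftrightarrow>
     (\<exists>m W. rep_direct_sum Q V m W \<and> (\<forall>j<m. stable_rep Q \<sigma> (W j)))"

definition locally_semi_simple ::
    "('v, 'a) pre_digraph \<Rightarrow> ('v, 'a, 'e::euclidean_space) quiver_rep \<Rightarrow> bool" where
  "locally_semi_simple Q V \<longleftrightarrow>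
     (\<exists>\<sigma>\<^sub>0 :: 'v \<Rightarrow> int. polystable_rep Q (\<lambda>x. real_of_int (\<sigma>\<^sub>0 x)) V)"


section \<open>The quiver and the representation of a matrix frame\<close>

text \<open>The vertex \<open>0\<close> is \<^term>\<open>None\<close>, the vertex \<open>i \<in> [n]\<close> is \<^term>\<open>Some i\<close>.\<close>

definition frame_quiver ::
    "('n::finite \<Rightarrow> 'k::finite set) \<Rightarrow> ('n option, 'n \<times> 'k) pre_digraph" where
  "frame_quiver J =
     \<lparr> verts = UNIV, arcs = {(i, l). l \<in> J i}, tail = (\<lambda>_. None), head = (\<lambda>(i, l). Some i) \<rparr>"

text \<open>
  The representations with \<open>\<real>\<^sup>d\<close> at \<open>0\<close> and \<open>\<real>\<close> at each \<open>i \<in> [n]\<close> are given by coordinates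
  \<open>M\<close>: row \<open>l\<close> of \<open>M $ i\<close> is the \<open>1 \<times> d\<close> matrix of the arrow \<open>(i, l)\<close> (zero if \<open>l \<notin> J i\<close>).
  As quiver representations, they live in the ambient space \<open>\<real>\<^sup>d \<times> \<real>\<close>.
\<close>

type_synonym ('d, 'k, 'n) rep_coords = "(real ^ 'd ^ 'k) ^ 'n"

definition rep_of ::
    "('d::finite, 'k::finite, 'n::finite) rep_coords \<Rightarrow>
     ('n option, 'n \<times> 'k, (real ^ 'd) \<times> real) quiver_rep" where
  "rep_of M =
     \<lparr> space_at = (\<lambda>x. case x of None \<Rightarrow> UNIV \<times> {0} | Some i \<Rightarrow> {0} \<times> UNIV),
       map_at = (\<lambda>(i, l) (v, s). (0, row l (M $ i) \<bullet> v)) \<rparr>"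

definition frame_coords ::
    "('d::finite, 'k::finite, 'n::finite) matrix_tuple \<Rightarrow> ('d, 'k, 'n) rep_coords" where
  "frame_coords F = (\<chi> i. transpose (F $ i))"

definition V_frame ::
    "('d::finite, 'k::finite, 'n::finite) matrix_tuple \<Rightarrow>
     ('n option, 'n \<times> 'k, (real ^ 'd) \<times> real) quiver_rep" where
  "V_frame F = rep_of (frame_coords F)"

definition rep_action ::
    "real ^ 'd::finite ^ 'd \<Rightarrow> real ^ 'n::finite \<Rightarrow>
     ('d, 'k::finite, 'n) rep_coords \<Rightarrow> ('d, 'k, 'n) rep_coords" where
  "rep_action A\<^sub>0 \<mu> M = (\<chi> i. (\<mu> $ i) *\<^sub>R (M $ i ** matrix_inv A\<^sub>0))"

definition rep_orbit ::
    "('d::finite, 'k::finite, 'n::finite) rep_coords \<Rightarrow> ('d, 'k, 'n) rep_coords set" where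
  "rep_orbit M = {rep_action A\<^sub>0 \<mu> M | A\<^sub>0 \<mu>. invertible A\<^sub>0 \<and> (\<forall>i. \<mu> $ i \<noteq> 0)}"

definition degenerates_to ::
    "('d::finite, 'k::finite, 'n::finite) matrix_tuple \<Rightarrow> ('d, 'k, 'n) matrix_tuple \<Rightarrow> bool" where
  "degenerates_to F F' \<longleftrightarrow> frame_coords F' \<in> closure (rep_orbit (frame_coords F))"

end

theory Submission
  imports Defs
begin

text \<open>
  By Cauchy--Binet, \<open>det (\<Sum>\<^sub>i exp t\<^sub>i X\<^sub>i X\<^sub>i\<^sup>T)\<close> is a sum of exponentials \<open>a\<^sub>f exp (t \<bullet> \<alpha>\<^sub>f)\<close> with
  \<open>a\<^sub>f \<ge> 0\<close>, over the selections \<open>f\<close> of \<open>d\<close> columns; \<open>\<alpha>\<^sub>f\<close> counts how many columns are taken from each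
  \<open>X\<^sub>i\<close>, and \<open>a\<^sub>f > 0\<close> iff the columns form a basis. If \<open>f\<close> maximises \<open>t \<bullet> \<alpha>\<^sub>f\<close>, then \<open>\<alpha>\<^sub>f\<close> attains the
  rank on every superlevel set of \<open>t\<close>, so Abel summation along these sets bounds
  \<open>\<Phi>(t) - t \<bullet> c\<close> from below by the slacks of the inequalities that define the orbit polytope.
  This gives finiteness exactly on the polytope. If \<open>c\<close> is a relative interior point, a translation of
  \<open>t\<close> along a tight set does not change the objective, so gaps of \<open>t\<close> at tight sets can be closed, and
  what remains is coercive; conversely at a minimiser every inequality tight at \<open>c\<close> is tight on the
  whole polytope. If \<open>A M(t) A\<^sup>T = I\<close> with \<open>M(t) = \<Sum>\<^sub>i exp t\<^sub>i X\<^sub>i X\<^sub>i\<^sup>T\<close>, the partial derivatives of the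
  objective are \<open>exp t\<^sub>i \<parallel>A X\<^sub>i\<parallel>\<^sup>2 - c\<^sub>i\<close>, so critical points are the same as radial isotropic positions, and by
  convexity they are minimisers. When the infimum is only finite, there are points with arbitrarily
  small gradient, and the frames \<open>exp (t\<^sub>i/2) A X\<^sub>i\<close> accumulate at a radial isotropic frame in the orbit
  closure.
\<close>

section \<open>Determinants and superlevel sets\<close>

text \<open>The matrix is the sum of \<open>\<tau> p\<close> times the outer square of
  \<open>x p\<close>. Leibniz expansion gives a sum over all maps \<open>f\<close>; summing it over
  all permutations completes the diagonal product to a second determinant. The factorial counts the
  orderings of a set of vectors; maps with a repeated value contribute zero.\<close>

lemma cauchy_binet_symmetrized:
  fixes x :: "'p::finite \<Rightarrow> real ^ 'd::finite" and \<tau> :: "'p \<Rightarrow> real"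
  shows "fact CARD('d) * det (\<chi> a. \<Sum>p\<in>UNIV. (\<tau> p * x p $ a) *s x p) =
    (\<Sum>f\<in>UNIV. (\<Prod>k\<in>UNIV. \<tau> (f k)) * (det (\<chi> k. x (f k)))\<^sup>2)"
proof -
  let ?P = "{\<pi>. \<pi> permutes (UNIV :: 'd set)}"
  let ?g = "\<lambda>f :: 'd \<Rightarrow> 'p. (\<Prod>k\<in>UNIV. \<tau> (f k)) * (\<Prod>k\<in>UNIV. x (f k) $ k) * det (\<chi> k. x (f k))"
  have "det (\<chi> a. \<Sum>p\<in>UNIV. (\<tau> p * x p $ a) *s x p) =
      (\<Sum>\<pi>\<in>?P. of_int (sign \<pi>) * (\<Prod>a\<in>UNIV. \<Sum>p\<in>UNIV. \<tau> p * x p $ a * x p $ \<pi> a))"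
    by (simp add: det_def)
  also have "\<dots> = (\<Sum>\<pi>\<in>?P. \<Sum>f\<in>UNIV.
      (\<Prod>k\<in>UNIV. \<tau> (f k)) * (\<Prod>k\<in>UNIV. x (f k) $ k) * (of_int (sign \<pi>) * (\<Prod>k\<in>UNIV. x (f k) $ \<pi> k)))"
    by (subst prod_sum_PiE) (simp_all add: PiE_UNIV_domain sum_distrib_left prod.distrib mult.assoc mult.left_commute)
  also have "\<dots> = (\<Sum>f\<in>UNIV. ?g f)"
    by (subst sum.swap) (simp add: det_def sum_distrib_left)
  finally have det_eq: "det (\<chi> a. \<Sum>p\<in>UNIV. (\<tau> p * x p $ a) *s x p) = (\<Sum>f\<in>UNIV. ?g f)" .
  \<comment> \<open>Permuting a selection preserves the product of the weights and multiplies the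
    determinant by the sign, which turns the remaining product into a Leibniz term.\<close>
  have perm: "?g (f \<circ> \<pi>) = (\<Prod>k\<in>UNIV. \<tau> (f k)) * det (\<chi> k. x (f k)) *
      (of_int (sign \<pi>) * (\<Prod>k\<in>UNIV. x (f (\<pi> k)) $ k))" if "\<pi> \<in> ?P" for f \<pi>
  proof -
    have "(\<Prod>k\<in>UNIV. \<tau> (f (\<pi> k))) = (\<Prod>k\<in>UNIV. \<tau> (f k))"
      using that prod.permute[of \<pi> UNIV "\<lambda>k. \<tau> (f k)"] by (simp add: comp_def)
    moreover have "det (\<chi> k. x (f (\<pi> k))) = of_int (sign \<pi>) * det (\<chi> k. x (f k))"
      using that det_permute_rows[of \<pi> "\<chi> k. x (f k)"] by simp
    ultimately show ?thesis by simp
  qed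
  have "fact CARD('d) * det (\<chi> a. \<Sum>p\<in>UNIV. (\<tau> p * x p $ a) *s x p) =
      (\<Sum>\<pi>\<in>?P. \<Sum>f\<in>UNIV. ?g f)"
    by (simp add: det_eq card_permutations[OF refl])
  also have "\<dots> = (\<Sum>\<pi>\<in>?P. \<Sum>f\<in>UNIV. ?g (f \<circ> \<pi>))"
  proof (rule sum.cong[OF refl])
    fix \<pi> assume "\<pi> \<in> ?P"
    then have b: "bij \<pi>" by (simp add: permutes_bij)
    show "(\<Sum>f\<in>UNIV. ?g f) = (\<Sum>f\<in>UNIV. ?g (f \<circ> \<pi>))"
      by (rule sum.reindex_bij_witness[where j = "\<lambda>f. f \<circ> inv \<pi>" and i = "\<lambda>f. f \<circ> \<pi>"])
        (use b in \<open>auto simp: comp_def bij_is_surj bij_is_inj surj_f_inv_f\<close>)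
  qed
  also have "\<dots> = (\<Sum>f\<in>UNIV. (\<Prod>k\<in>UNIV. \<tau> (f k)) * det (\<chi> k. x (f k)) *
      (\<Sum>\<pi>\<in>?P. of_int (sign \<pi>) * (\<Prod>k\<in>UNIV. x (f (\<pi> k)) $ k)))"
    by (subst sum.swap) (simp only: sum_distrib_left perm cong: sum.cong)
  also have "\<dots> = (\<Sum>f\<in>UNIV. (\<Prod>k\<in>UNIV. \<tau> (f k)) * (det (\<chi> k. x (f k)))\<^sup>2)"
  proof (rule sum.cong[OF refl])
    fix f :: "'d \<Rightarrow> 'p"
    have "(\<Sum>\<pi>\<in>?P. of_int (sign \<pi>) * (\<Prod>k\<in>UNIV. x (f (\<pi> k)) $ k)) =
        det (transpose (\<chi> k. x (f k)))"
      by (simp add: det_def transpose_def)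
    then show "(\<Prod>k\<in>UNIV. \<tau> (f k)) * det (\<chi> k. x (f k)) *
      (\<Sum>\<pi>\<in>?P. of_int (sign \<pi>) * (\<Prod>k\<in>UNIV. x (f (\<pi> k)) $ k)) =
      (\<Prod>k\<in>UNIV. \<tau> (f k)) * (det (\<chi> k. x (f k)))\<^sup>2"
      by (simp add: det_transpose power2_eq_square)
  qed
  finally show ?thesis .
qed

text \<open>Abel summation: the sum of \<open>t i * w i\<close> is the sum over the gaps between
  consecutive values of \<open>t\<close> of the gap times the \<open>w\<close>-mass above it. The
  lowest level contributes nothing because the total mass is zero.\<close>

lemma layer_cake_le:
  fixes t w :: "'n::finite \<Rightarrow> real"
  assumes "(\<Sum>i\<in>UNIV. w i) = 0" "\<delta> \<ge> 0"
    and "\<And>s. {i. s \<le> t i} \<noteq> {} \<Longrightarrow> {i. s \<le> t i} \<noteq> UNIV \<Longrightarrow> \<delta> \<le> (\<Sum>i | s \<le> t i. w i)"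
  shows "\<delta> * (t i - t j) \<le> (\<Sum>i\<in>UNIV. t i * w i)"
  using assms(3)
proof (induction "card (range t)" arbitrary: t rule: less_induct)
  case less
  define m where "m = Max (range t)"
  have m: "m \<in> range t" "\<And>i. t i \<le> m" by (auto simp: m_def)
  show ?case
  proof (cases "range t = {m}")
    case True
    then have "t = (\<lambda>_. m)" by (auto simp: fun_eq_iff)
    then show ?thesis using assms(1) by (simp flip: sum_distrib_left)
  next
    case False
    define m' where "m' = Max (range t - {m})"
    have ne: "range t - {m} \<noteq> {}" using False m(1) by blast
    then have m': "m' \<in> range t - {m}" unfolding m'_def by (intro Max_in) auto
    have m'_ge: "t i \<le> m'" if "t i \<noteq> m" for i unfolding m'_def using that by (intro Max_ge) auto
    have "m' < m" using m' m(2) by (metis DiffE imageE insertCI order_le_less)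
    \<comment> \<open>Cutting the top value down to the second largest merges two levels, so the
      induction hypothesis applies.\<close>
    define t' where "t' i = min (t i) m'" for i
    have "range t' \<subseteq> range t - {m}"
      using m' m'_ge \<open>m' < m\<close> by (auto simp: t'_def min_def)
    then have "card (range t') < card (range t)"
      using m(1) by (intro psubset_card_mono) auto
    moreover have "\<delta> \<le> (\<Sum>i | s \<le> t' i. w i)" if "{i. s \<le> t' i} \<noteq> {}" "{i. s \<le> t' i} \<noteq> UNIV" for s
    proof -
      have "{i. s \<le> t' i} = {i. s \<le> t i}" using that(1) by (auto simp: t'_def)
      then show ?thesis using less.prems[of s] that by simp
    qed
    ultimately have IH: "\<delta> * (t' i - t' j) \<le> (\<Sum>i\<in>UNIV. t' i * w i)" by (rule less.hyps)
    have top: "\<delta> \<le> (\<Sum>i | m \<le> t i. w i)"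
    proof (rule less.prems)
      show "{i. m \<le> t i} \<noteq> {}" using m(1) by auto
      obtain j where "t j = m'" using m' by auto
      then show "{i. m \<le> t i} \<noteq> UNIV" using \<open>m' < m\<close> by (auto simp: set_eq_iff intro!: exI[of _ j])
    qed
    have "t i * w i = t' i * w i + (if m \<le> t i then (m - m') * w i else 0)" for i
      using m(2)[of i] m'_ge[of i] \<open>m' < m\<close> by (auto simp: t'_def min_def algebra_simps)
    then have "(\<Sum>i\<in>UNIV. t i * w i) = (\<Sum>i\<in>UNIV. t' i * w i) + (m - m') * (\<Sum>i | m \<le> t i. w i)"
      by (simp add: sum.distrib sum_distrib_left flip: sum.inter_filter)
    moreover have "(m - m') * \<delta> \<le> (m - m') * (\<Sum>i | m \<le> t i. w i)"
      using top \<open>m' < m\<close> by (intro mult_left_mono) auto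
    moreover have "\<delta> * (t i - t j) \<le> \<delta> * (t' i - t' j + (m - m'))"
      using assms(2) m(2)[of i] m'_ge[of i] \<open>m' < m\<close> by (intro mult_left_mono) (auto simp: t'_def min_def)
    ultimately show ?thesis using IH by (simp add: algebra_simps)
  qed
qed

text \<open>Jacobi's formula at the identity. Only the identity permutation survives: any other one
  moves at least two indices, so an off-diagonal zero of the identity matrix remains
  undifferentiated.\<close>

lemma has_derivative_det_perturbation:
  fixes P :: "real ^ 'd::finite ^ 'd"
  shows "((\<lambda>s. det (mat 1 + s *\<^sub>R P)) has_real_derivative trace P) (at 0)"
proof -
  let ?P = "{\<pi>. \<pi> permutes (UNIV :: 'd set)}"
  have "((\<lambda>s. \<Sum>\<pi>\<in>?P. of_int (sign \<pi>) * (\<Prod>i\<in>UNIV. (mat 1 :: real^'d^'d) $ i $ \<pi> i + s * P $ i $ \<pi> i))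
     has_real_derivative (\<Sum>\<pi>\<in>?P. of_int (sign \<pi>) *
       (\<Sum>i\<in>UNIV. P $ i $ \<pi> i * (\<Prod>j\<in>UNIV - {i}. (mat 1 :: real^'d^'d) $ j $ \<pi> j + 0 * P $ j $ \<pi> j)))) (at 0)"
    by (intro DERIV_sum DERIV_cmult has_field_derivative_prod) (auto intro!: derivative_eq_intros)
  moreover have "(\<Sum>\<pi>\<in>?P. of_int (sign \<pi>) *
       (\<Sum>i\<in>UNIV. P $ i $ \<pi> i * (\<Prod>j\<in>UNIV - {i}. (mat 1 :: real^'d^'d) $ j $ \<pi> j + 0 * P $ j $ \<pi> j))) =
      (\<Sum>\<pi>\<in>?P. if \<pi> = id then trace P else 0)"
  proof (rule sum.cong[OF refl])
    fix \<pi> assume \<pi>: "\<pi> \<in> ?P"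
    show "of_int (sign \<pi>) *
       (\<Sum>i\<in>UNIV. P $ i $ \<pi> i * (\<Prod>j\<in>UNIV - {i}. (mat 1 :: real^'d^'d) $ j $ \<pi> j + 0 * P $ j $ \<pi> j)) =
      (if \<pi> = id then trace P else 0)"
    proof (cases "\<pi> = id")
      case True
      then show ?thesis by (simp add: mat_def trace_def)
    next
      case False
      have "(\<Prod>j\<in>UNIV - {i}. (mat 1 :: real^'d^'d) $ j $ \<pi> j + 0 * P $ j $ \<pi> j) = 0" for i
      proof -
        obtain k where k: "\<pi> k \<noteq> k" using False by (auto simp: fun_eq_iff)
        have "\<pi> (\<pi> k) \<noteq> \<pi> k" using k \<pi> by (metis mem_Collect_eq permutes_inj injD)
        with k have "\<exists>j. j \<noteq> i \<and> \<pi> j \<noteq> j" by metis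
        then obtain j where "j \<noteq> i" "\<pi> j \<noteq> j" by blast
        then show ?thesis by (intro prod_zero) (auto simp: mat_def intro!: bexI[of _ j])
      qed
      then show ?thesis by (simp only: False if_False mult_zero_right sum.neutral_const)
    qed
  qed
  moreover have "(\<Sum>\<pi>\<in>?P. if \<pi> = id then trace P else 0) = trace P"
    by (simp add: sum.delta' permutes_id)
  ultimately show ?thesis by (simp add: det_def)
qed

text \<open>Gram-Schmidt for the inner product \<open>u \<bullet> (M *v v)\<close>; the rows of
  \<open>A\<close> are an orthonormal basis for it.\<close>

lemma congruent_to_identity:
  fixes M :: "real ^ 'd::finite ^ 'd"
  assumes "positive_definite M"
  obtains A :: "real ^ 'd ^ 'd" where "A ** M ** transpose A = mat 1"
proof -
  have sym: "u \<bullet> (M *v v) = v \<bullet> (M *v u)" for u v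
    using assms by (metis positive_definite_def dot_lmul_matrix inner_commute matrix_transpose_mul transpose_matrix_vector)
  have "\<exists>r :: nat \<Rightarrow> real ^ 'd. \<forall>a<k. \<forall>b<k. r a \<bullet> (M *v r b) = (if a = b then 1 else 0)"
    if "k \<le> CARD('d)" for k
    using that
  proof (induction k)
    case (Suc k)
    then obtain r :: "nat \<Rightarrow> real ^ 'd"
      where r: "\<And>a b. a < k \<Longrightarrow> b < k \<Longrightarrow> r a \<bullet> (M *v r b) = (if a = b then 1 else 0)" by force
    \<comment> \<open>Fewer than \<open>CARD('d)\<close> vectors \<open>M *v r a\<close> leave a
      nonzero \<open>v\<close> orthogonal to all of them.\<close>
    let ?S = "(\<lambda>a. M *v r a) ` {..<k}"
    have "dim ?S \<le> card ?S" by (intro dim_le_card') auto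
    also have "\<dots> \<le> k" using card_image_le[of "{..<k}"] by fastforce
    finally have "dim ?S < DIM(real ^ 'd)" using Suc.prems by simp
    then obtain v where v: "v \<noteq> 0" "\<And>y. y \<in> span ?S \<Longrightarrow> orthogonal v y"
      using orthogonal_to_subspace_exists by blast
    have ortho: "v \<bullet> (M *v r a) = 0" if "a < k" for a
      using v(2)[OF span_base] that by (auto simp: orthogonal_def)
    define q where "q = v \<bullet> (M *v v)"
    have q: "q > 0" using assms v(1) by (simp add: q_def positive_definite_def)
    define r' where "r' = r(k := (1 / sqrt q) *\<^sub>R v)"
    have "r' a \<bullet> (M *v r' b) = (if a = b then 1 else 0)" if "a < Suc k" "b < Suc k" for a b
      using that q r[of a b] ortho[of a] ortho[of b] sym[of "r a" v]
      by (auto simp: r'_def less_Suc_eq matrix_vector_mult_scaleR q_def[symmetric] real_sqrt_mult_self)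
    then show ?case by blast
  qed auto
  from this[of "CARD('d)"] obtain r :: "nat \<Rightarrow> real ^ 'd" where
    r: "\<And>a b. a < CARD('d) \<Longrightarrow> b < CARD('d) \<Longrightarrow> r a \<bullet> (M *v r b) = (if a = b then 1 else 0)" by auto
  obtain e :: "'d \<Rightarrow> nat" where e: "bij_betw e UNIV {0..<CARD('d)}"
    using ex_bij_betw_finite_nat[of "UNIV :: 'd set"] by auto
  define A :: "real ^ 'd ^ 'd" where "A = (\<chi> a. r (e a))"
  have "(A ** M ** transpose A) $ a $ b = r (e a) \<bullet> (M *v r (e b))" for a b
    by (simp add: A_def matrix_matrix_mult_def matrix_vector_mult_def transpose_def inner_vec_def
        sum_distrib_left sum_distrib_right mult.assoc) (rule sum.swap)
  moreover have "e a < CARD('d)" "e a = e b \<longleftrightarrow> a = b" for a b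
    using e by (auto simp: bij_betw_def inj_on_def)
  ultimately have "A ** M ** transpose A = mat 1" by (simp add: vec_eq_iff mat_def r)
  then show thesis by (rule that)
qed

section \<open>The exponential sum of a frame and its orbit polytope\<close>

definition frame_gram :: "('d::finite, 'k::finite, 'n::finite) matrix_tuple \<Rightarrow> real ^ 'n \<Rightarrow> real ^ 'd ^ 'd" where
  "frame_gram F t = (\<Sum>i\<in>UNIV. exp (t $ i) *\<^sub>R (F $ i ** transpose (F $ i)))"

text \<open>The type \<open>'d\<close> also indexes the choices, so selections are ordered and may
  repeat a column. The columns are stored as rows, which does not affect the determinant.\<close>

definition selected_columns ::
    "('d::finite, 'k::finite, 'n::finite) matrix_tuple \<Rightarrow> ('d \<Rightarrow> 'n \<times> 'k) \<Rightarrow> real ^ 'd ^ 'd" where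
  "selected_columns F f = (\<chi> a. column (snd (f a)) (F $ fst (f a)))"

text \<open>The factorial compensates for counting every ordering of the same columns.\<close>

definition selection_coeff :: "('d::finite, 'k::finite, 'n::finite) matrix_tuple \<Rightarrow> ('d \<Rightarrow> 'n \<times> 'k) \<Rightarrow> real" where
  "selection_coeff F f = (det (selected_columns F f))\<^sup>2 / fact CARD('d)"

definition expo :: "('d::finite \<Rightarrow> 'n::finite \<times> 'k::finite) \<Rightarrow> real ^ 'n" where
  "expo f = (\<Sum>a\<in>UNIV. axis (fst (f a)) 1)"

definition indicator_vec :: "'n::finite set \<Rightarrow> real ^ 'n" where
  "indicator_vec I = (\<chi> i. if i \<in> I then 1 else 0)"

abbreviation frame_rank :: "('d::finite, 'k::finite, 'n::finite) matrix_tuple \<Rightarrow> 'n set \<Rightarrow> real" where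
  "frame_rank F I \<equiv> real (dim (\<Sum>i\<in>I. Col (F $ i)))"

definition objective :: "('d::finite, 'k::finite, 'n::finite) matrix_tuple \<Rightarrow> real ^ 'n \<Rightarrow> real ^ 'n \<Rightarrow> real" where
  "objective F c t = Phi F t - t \<bullet> c"

lemma indicator_vec_inner [simp]: "indicator_vec I \<bullet> x = (\<Sum>i\<in>I. x $ i)"
  by (simp add: indicator_vec_def inner_vec_def if_distrib[of "\<lambda>y. y * _"] sum.If_cases cong: if_cong)

lemma inner_expo: "t \<bullet> expo f = (\<Sum>a\<in>UNIV. t $ fst (f a))"
  by (simp add: expo_def inner_sum_right inner_axis)

lemma sum_expo: "(\<Sum>i\<in>I. expo f $ i) = real (card {a. fst (f a) \<in> I})"
proof -
  have "(\<Sum>i\<in>I. expo f $ i) = (\<Sum>a\<in>UNIV. if fst (f a) \<in> I then 1 else 0)"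
    by (simp only: indicator_vec_inner[symmetric] inner_expo) (simp add: indicator_vec_def)
  then show ?thesis by (simp add: sum.If_cases)
qed

lemma matrix_mult_transpose_entry:
  fixes X :: "real ^ 'k::finite ^ 'd::finite"
  shows "(X ** transpose X) $ a $ b = (\<Sum>l\<in>UNIV. column l X $ a * column l X $ b)"
  by (simp add: matrix_matrix_mult_def transpose_def column_def)

lemma inner_mult_transpose:
  fixes X :: "real ^ 'k::finite ^ 'd::finite"
  shows "v \<bullet> ((X ** transpose X) *v v) = (norm (transpose X *v v))\<^sup>2"
  by (simp add: matrix_vector_mul_assoc[symmetric] dot_lmul_matrix[symmetric]
      power2_norm_eq_inner transpose_matrix_vector)

lemma trace_mult_transpose:
  fixes X :: "real ^ 'k::finite ^ 'd::finite"
  shows "trace (X ** transpose X) = (norm X)\<^sup>2"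
  by (simp add: trace_def matrix_matrix_mult_def transpose_def power2_norm_eq_inner inner_vec_def)

text \<open>Cauchy-Binet over all columns of all blocks, with weight \<open>exp (t $ i)\<close> on
  the columns of block \<open>i\<close>.\<close>

lemma det_frame_gram:
  fixes F :: "('d::finite, 'k::finite, 'n::finite) matrix_tuple"
  shows "det (frame_gram F t) = (\<Sum>f\<in>UNIV. selection_coeff F f * exp (t \<bullet> expo f))"
proof -
  let ?x = "\<lambda>p :: 'n \<times> 'k. column (snd p) (F $ fst p)"
  have "frame_gram F t = (\<chi> a. \<Sum>p\<in>UNIV. (exp (t $ fst p) * ?x p $ a) *s ?x p)"
    by (simp add: vec_eq_iff frame_gram_def matrix_mult_transpose_entry sum_distrib_left
        sum.cartesian_product' UNIV_Times_UNIV[symmetric] mult.assoc del: UNIV_Times_UNIV)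
  then have "fact CARD('d) * det (frame_gram F t) =
      (\<Sum>f\<in>UNIV. (\<Prod>k\<in>UNIV. exp (t $ fst (f k))) * (det (\<chi> k. ?x (f k)))\<^sup>2)"
    using cauchy_binet_symmetrized[of "\<lambda>p. exp (t $ fst p)" ?x] by simp
  also have "\<dots> = (\<Sum>f\<in>UNIV. fact CARD('d) * (selection_coeff F f * exp (t \<bullet> expo f)))"
    by (simp add: selection_coeff_def selected_columns_def inner_expo exp_sum mult.commute)
  finally show ?thesis by (simp flip: sum_distrib_left)
qed

lemma selection_coeff_nonneg: "selection_coeff F f \<ge> 0"
  by (simp add: selection_coeff_def)

lemma selection_coeff_pos_iff: "selection_coeff F f > 0 \<longleftrightarrow> det (selected_columns F f) \<noteq> 0"
  by (simp add: selection_coeff_def zero_less_divide_iff)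

lemma sum_Col: "(\<Sum>i\<in>I. Col (F $ i)) = span (\<Union>i\<in>I. columns (F $ i))"
  for F :: "('d::finite, 'k::finite, 'n::finite) matrix_tuple"
proof -
  have "finite I" by simp
  then show ?thesis
    by induction (simp_all add: span_Un set_plus_def set_zero, blast)
qed

lemma frame_rank_eq: "frame_rank F I = real (dim (\<Union>i\<in>I. columns (F $ i)))"
  by (simp add: sum_Col)

text \<open>A nonzero determinant makes the selected columns distinct and independent, and those
  taken from blocks in \<open>I\<close> lie in the span of these blocks.\<close>

lemma expo_le_rank:
  fixes F :: "('d::finite, 'k::finite, 'n::finite) matrix_tuple"
  assumes "selection_coeff F f > 0"
  shows "(\<Sum>i\<in>I. expo f $ i) \<le> frame_rank F I"
proof -
  let ?x = "\<lambda>a. column (snd (f a)) (F $ fst (f a))" and ?S = "{a. fst (f a) \<in> I}"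
  have inj: "inj ?x" and ind: "independent (range ?x)"
  proof -
    have nz: "det (selected_columns F f) \<noteq> 0" using assms by (simp add: selection_coeff_pos_iff)
    have rows: "row a (selected_columns F f) = ?x a" for a
      by (simp add: row_def selected_columns_def vec_eq_iff)
    have "rows (selected_columns F f) = range ?x" by (auto simp: rows_def rows)
    with nz show "independent (range ?x)"
      using det_dependent_rows[of "selected_columns F f"] by (auto simp: dependent_vec_eq)
    show "inj ?x"
    proof (rule injI, rule ccontr)
      fix a b assume "?x a = ?x b" "a \<noteq> b"
      with nz show False using det_identical_rows[of a b "selected_columns F f"] by (simp add: rows)
    qed
  qed
  have "card ?S = card (?x ` ?S)"
    using inj by (simp add: card_image inj_on_subset)
  also have "\<dots> = dim (?x ` ?S)"
    using ind independent_mono[OF ind, of "?x ` ?S"] by (simp add: dim_eq_card_independent image_mono)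
  also have "\<dots> \<le> dim (\<Union>i\<in>I. columns (F $ i))"
    by (intro dim_subset) (auto simp: columns_def)
  finally show ?thesis by (simp add: sum_expo frame_rank_eq)
qed

lemma sum_expo_UNIV: "(\<Sum>i\<in>UNIV. expo f $ i) = real CARD('d)"
  for f :: "'d::finite \<Rightarrow> 'n::finite \<times> 'k::finite"
  by (simp add: sum_expo)

lemma sum_matrix_vector_mult: "sum M I *v v = (\<Sum>i\<in>I. M i *v v)"
  for M :: "'i \<Rightarrow> real ^ 'm::finite ^ 'l::finite"
  by (induction I rule: infinite_finite_induct) (simp_all add: matrix_vector_mult_add_rdistrib)

section \<open>Positivity of the Gram matrices and greedy selections\<close>

locale frame =
  fixes F :: "('d::finite, 'k::finite, 'n::finite) matrix_tuple"
  assumes gram_pd: "positive_definite (\<Sum>i\<in>UNIV. F $ i ** transpose (F $ i))"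
begin

lemma frame_gram_pd: "positive_definite (frame_gram F t)"
  unfolding positive_definite_def
proof (intro conjI allI impI)
  show "transpose (frame_gram F t) = frame_gram F t"
    unfolding vec_eq_iff transpose_def[of "frame_gram F t"]
    by (simp add: frame_gram_def matrix_mult_transpose_entry mult.commute)
  fix v :: "real ^ 'd" assume "v \<noteq> 0"
  have quad: "v \<bullet> ((\<Sum>i\<in>UNIV. a i *\<^sub>R (F $ i ** transpose (F $ i))) *v v) =
      (\<Sum>i\<in>UNIV. a i * (norm (transpose (F $ i) *v v))\<^sup>2)" for a :: "'n \<Rightarrow> real"
    by (simp add: sum_matrix_vector_mult inner_sum_right scaleR_matrix_vector_assoc[symmetric] inner_mult_transpose)
  have "0 < (\<Sum>i\<in>UNIV. (norm (transpose (F $ i) *v v))\<^sup>2)"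
    using gram_pd \<open>v \<noteq> 0\<close> quad[of "\<lambda>_. 1"] by (auto simp: positive_definite_def)
  \<comment> \<open>A square that is positive stays positive under the weights
    \<open>exp (t $ i)\<close>.\<close>
  then obtain i where i: "(norm (transpose (F $ i) *v v))\<^sup>2 > 0"
    by (meson not_less sum_nonpos)
  show "v \<bullet> (frame_gram F t *v v) > 0"
    unfolding frame_gram_def quad by (rule sum_pos2[of _ i]) (use i in auto)
qed

text \<open>Congruence to the identity excludes zero and the exponential sum excludes negative
  values. Hence \<open>ln\<close> in \<open>Phi\<close> is applied to positive numbers only.\<close>

lemma det_frame_gram_pos: "det (frame_gram F t) > 0"
proof -
  obtain A :: "real ^ 'd ^ 'd" where "A ** frame_gram F t ** transpose A = mat 1"
    using congruent_to_identity[OF frame_gram_pd] by metis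
  then have "det A * det (frame_gram F t) * det A = 1"
    by (metis det_I det_mul det_transpose)
  then have "det (frame_gram F t) \<noteq> 0" by auto
  moreover have "det (frame_gram F t) \<ge> 0"
    by (simp add: det_frame_gram sum_nonneg selection_coeff_nonneg)
  ultimately show ?thesis by simp
qed

lemma ex_selection_coeff_pos: "\<exists>f. selection_coeff F f > 0"
proof (rule ccontr)
  assume "\<nexists>f. selection_coeff F f > 0"
  then have "selection_coeff F f = 0" for f using selection_coeff_nonneg[of F f] by (metis order_le_less)
  then show False using det_frame_gram_pos[of 0] by (simp add: det_frame_gram)
qed

lemma Phi_eq: "Phi F t = ln (det (frame_gram F t))"
  by (simp add: Phi_def frame_gram_def)

text \<open>Without the logarithm, values of the objective can be compared term by term.\<close>

lemma exp_objective: "exp (objective F c t) = (\<Sum>f\<in>UNIV. selection_coeff F f * exp (t \<bullet> (expo f - c)))"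
  using det_frame_gram_pos[of t]
  by (simp add: objective_def Phi_eq exp_diff det_frame_gram inner_diff_right sum_divide_distrib)


text \<open>A selection maximising \<open>t \<bullet> expo f\<close> is greedy: otherwise a chosen column of smaller weight
  could be exchanged for one that the chosen columns of larger weight do not span.\<close>

lemma greedy_selection:
  fixes t :: "real ^ 'n"
  obtains f where "selection_coeff F f > 0"
    "\<And>s. (\<Sum>i | s \<le> t $ i. expo f $ i) = frame_rank F {i. s \<le> t $ i}"
proof -
  have fin: "finite {f. selection_coeff F f > 0}" and ne: "{f. selection_coeff F f > 0} \<noteq> {}" using ex_selection_coeff_pos by auto
  define f where "f = arg_min_on (\<lambda>f. - (t \<bullet> expo f)) {f. selection_coeff F f > 0}"
  have f: "selection_coeff F f > 0" and f_max: "\<And>g. selection_coeff F g > 0 \<Longrightarrow> t \<bullet> expo g \<le> t \<bullet> expo f"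
    using arg_min_if_finite[OF fin ne, of "\<lambda>f. - (t \<bullet> expo f)"] by (force simp: f_def not_less)+
  have "(\<Sum>i | s \<le> t $ i. expo f $ i) = frame_rank F {i. s \<le> t $ i}" for s
  proof (rule antisym[OF expo_le_rank[OF f]], rule ccontr)
    define I where "I = {i. s \<le> t $ i}"
    define A where "A = selected_columns F f"
    assume "\<not> frame_rank F {i. s \<le> t $ i} \<le> (\<Sum>i | s \<le> t $ i. expo f $ i)"
    then have less: "card {a. fst (f a) \<in> I} < dim (\<Union>i\<in>I. columns (F $ i))"
      by (simp add: frame_rank_eq sum_expo I_def[symmetric])
    have "dim ((\<lambda>a. row a A) ` {a. fst (f a) \<in> I}) \<le> card {a. fst (f a) \<in> I}"
      by (intro order_trans[OF dim_le_card'] card_image_le) auto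
    with less have "\<not> (\<Union>i\<in>I. columns (F $ i)) \<subseteq> span ((\<lambda>a. row a A) ` {a. fst (f a) \<in> I})"
      using dim_subset[of "\<Union>i\<in>I. columns (F $ i)" "span ((\<lambda>a. row a A) ` {a. fst (f a) \<in> I})"] by auto
    then obtain i l where i: "i \<in> I"
      and notin: "column l (F $ i) \<notin> span ((\<lambda>a. row a A) ` {a. fst (f a) \<in> I})"
      by (auto simp: columns_def)
    have nz: "det A \<noteq> 0" using f by (simp add: A_def selection_coeff_pos_iff)
    then have "invertible (transpose A)" by (simp add: invertible_det_nz det_transpose)
    then obtain B where "transpose A ** B = mat 1" by (auto simp: invertible_def)
    then have "transpose A *v (B *v column l (F $ i)) = column l (F $ i)"
      by (simp add: matrix_vector_mul_assoc)
    then obtain y where y: "column l (F $ i) = (\<Sum>a\<in>UNIV. y $ a *s row a A)"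
      by (metis (no_types, lifting) matrix_mult_sum column_transpose sum.cong)
    \<comment> \<open>A column outside the span of the rows taken from \<open>I\<close> must involve
      a row \<open>k\<close> from elsewhere, and that row is exchanged.\<close>
    have "\<exists>k. y $ k \<noteq> 0 \<and> fst (f k) \<notin> I"
    proof (rule ccontr)
      assume "\<nexists>k. y $ k \<noteq> 0 \<and> fst (f k) \<notin> I"
      then have "row a A \<in> span ((\<lambda>a. row a A) ` {a. fst (f a) \<in> I})" if "y $ a \<noteq> 0" for a
        using that by (intro span_base imageI) auto
      then have "y $ a *s row a A \<in> span ((\<lambda>a. row a A) ` {a. fst (f a) \<in> I})" for a
        by (cases "y $ a = 0") (simp_all add: span_zero scalar_mult_eq_scaleR span_scale)
      then show False using notin unfolding y by (auto intro: span_sum)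
    qed
    then obtain k where k: "y $ k \<noteq> 0" "fst (f k) \<notin> I" by blast
    define g where "g = f(k := (i, l))"
    have "selected_columns F g = (\<chi> a. if a = k then column l (F $ i) else row a A)"
      by (simp add: g_def selected_columns_def A_def row_def vec_eq_iff)
    \<comment> \<open>Cramer's rule: replacing row \<open>k\<close> by the combination
      \<open>y\<close> of the rows multiplies the determinant by \<open>y $ k\<close>.\<close>
    then have "det (selected_columns F g) = y $ k * det A"
      using cramer_lemma_transpose[of k y A] by (simp only: y)
    then have "selection_coeff F g > 0" using k(1) nz by (simp add: selection_coeff_pos_iff)
    moreover have "t \<bullet> expo g = t \<bullet> expo f - t $ fst (f k) + t $ i"
      by (simp add: inner_expo g_def sum.remove[of UNIV k])
    ultimately show False using f_max[of g] k(2) i by (auto simp: I_def)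
  qed
  then show thesis using f that by blast
qed

section \<open>Lower bounds for the objective\<close>

text \<open>A sum of nonnegative terms dominates each of them; this constant accounts for the
  coefficient of such a term, uniformly in the selection, \<open>t\<close> and
  \<open>c\<close>.\<close>

definition objective_floor :: real where
  "objective_floor = Min ((\<lambda>f. ln (selection_coeff F f)) ` {f. selection_coeff F f > 0})"

lemma objective_ge_term:
  assumes "selection_coeff F f > 0"
  shows "objective_floor + t \<bullet> (expo f - c) \<le> objective F c t"
proof -
  have "exp (ln (selection_coeff F f) + t \<bullet> (expo f - c)) \<le> exp (objective F c t)"
    unfolding exp_objective using assms
    by (auto simp: exp_add selection_coeff_nonneg intro!: member_le_sum[of f UNIV "\<lambda>f. selection_coeff F f * exp (t \<bullet> (expo f - c))"])
  moreover have "objective_floor \<le> ln (selection_coeff F f)"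
    unfolding objective_floor_def using assms by (intro Min_le) auto
  ultimately show ?thesis by simp
qed

text \<open>On each proper superlevel set, the greedy selection for \<open>t\<close> exceeds
  \<open>c\<close> by at least \<open>\<delta>\<close>, so \<open>layer_cake_le\<close> bounds its
  term. With \<open>\<delta> = 0\<close> this bounds the objective on the polytope; with
  \<open>\<delta> > 0\<close> it controls the spread of \<open>t\<close>. Only superlevel sets of
  the given \<open>t\<close> need slack, which is what gap closing can provide.\<close>

lemma objective_lower_bound:
  assumes "(\<Sum>i\<in>UNIV. c $ i) = real CARD('d)" "\<delta> \<ge> 0"
    and "\<And>s. {i. s \<le> t $ i} \<noteq> {} \<Longrightarrow> {i. s \<le> t $ i} \<noteq> UNIV \<Longrightarrow>
      (\<Sum>i | s \<le> t $ i. c $ i) + \<delta> \<le> frame_rank F {i. s \<le> t $ i}"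
  shows "objective_floor + \<delta> * (t $ i - t $ j) \<le> objective F c t"
proof -
  obtain f where f: "selection_coeff F f > 0"
    "\<And>s. (\<Sum>i | s \<le> t $ i. expo f $ i) = frame_rank F {i. s \<le> t $ i}"
    using greedy_selection[of t] by blast
  have "\<delta> * (t $ i - t $ j) \<le> (\<Sum>i\<in>UNIV. t $ i * (expo f $ i - c $ i))"
  proof (rule layer_cake_le)
    show "(\<Sum>i\<in>UNIV. expo f $ i - c $ i) = 0" by (simp add: sum_subtractf sum_expo_UNIV assms(1))
    show "\<delta> \<le> (\<Sum>i | s \<le> t $ i. expo f $ i - c $ i)"
      if "{i. s \<le> t $ i} \<noteq> {}" "{i. s \<le> t $ i} \<noteq> UNIV" for s
      using assms(3)[OF that] f(2)[of s] by (simp add: sum_subtractf)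
  qed (fact assms(2))
  also have "\<dots> = t \<bullet> (expo f - c)" by (simp add: inner_vec_def)
  finally show ?thesis using objective_ge_term[OF f(1), of t c] by simp
qed

lemma objective_floor_le:
  assumes "c \<in> orbit_polytope F"
  shows "objective_floor \<le> objective F c t"
  \<comment> \<open>With \<open>\<delta> = 0\<close> the difference of coordinates drops out, so any
    two indices do.\<close>
  using objective_lower_bound[of c 0 t undefined undefined] assms by (simp add: orbit_polytope_def)

lemma expo_in_orbit_polytope:
  assumes "selection_coeff F f > 0"
  shows "expo f \<in> orbit_polytope F"
proof -
  have "0 \<le> expo f $ i" for i using sum_expo[of f "{i}"] by simp
  then show ?thesis
    using expo_le_rank[OF assms] sum_expo_UNIV[of f] unfolding orbit_polytope_def by blast
qed

section \<open>Translations along indicator vectors\<close>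

lemma exp_objective_shift:
  "exp (objective F c (t + s *\<^sub>R indicator_vec I)) =
    (\<Sum>f\<in>UNIV. selection_coeff F f * exp (t \<bullet> (expo f - c)) * exp (s * ((\<Sum>i\<in>I. expo f $ i) - (\<Sum>i\<in>I. c $ i))))"
  by (simp add: exp_objective inner_add_left exp_add sum_subtractf mult.assoc)

lemma objective_shift_le:
  assumes "\<And>f. selection_coeff F f > 0 \<Longrightarrow> s * ((\<Sum>i\<in>I. expo f $ i) - (\<Sum>i\<in>I. c $ i)) \<le> q"
  shows "objective F c (t + s *\<^sub>R indicator_vec I) \<le> objective F c t + q"
proof -
  have "exp (objective F c (t + s *\<^sub>R indicator_vec I)) \<le>
      (\<Sum>f\<in>UNIV. selection_coeff F f * exp (t \<bullet> (expo f - c)) * exp q)"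
    unfolding exp_objective_shift
  proof (rule sum_mono)
    fix f show "selection_coeff F f * exp (t \<bullet> (expo f - c)) * exp (s * ((\<Sum>i\<in>I. expo f $ i) - (\<Sum>i\<in>I. c $ i))) \<le>
      selection_coeff F f * exp (t \<bullet> (expo f - c)) * exp q"
      using assms[of f] selection_coeff_nonneg[of F f] by (cases "selection_coeff F f = 0") auto
  qed
  also have "\<dots> = exp (objective F c t + q)"
    by (simp add: exp_add exp_objective sum_distrib_right)
  finally show ?thesis by simp
qed

lemma objective_shift_eq:
  assumes "\<And>f. selection_coeff F f > 0 \<Longrightarrow> (\<Sum>i\<in>I. expo f $ i) = (\<Sum>i\<in>I. c $ i) + q"
  shows "objective F c (t + s *\<^sub>R indicator_vec I) = objective F c t + s * q"
  using objective_shift_le[of s I c "s * q" t] objective_shift_le[of "- s" I c "- s * q" "t + s *\<^sub>R indicator_vec I"]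
  by (simp add: assms)

lemma objective_shift_less:
  assumes "\<And>f. selection_coeff F f > 0 \<Longrightarrow> (\<Sum>i\<in>I. expo f $ i) \<le> (\<Sum>i\<in>I. c $ i)"
    and "selection_coeff F g > 0" "(\<Sum>i\<in>I. expo g $ i) < (\<Sum>i\<in>I. c $ i)"
  shows "objective F c (t + indicator_vec I) < objective F c t"
proof -
  have "exp (objective F c (t + 1 *\<^sub>R indicator_vec I)) < exp (objective F c t)"
    unfolding exp_objective_shift unfolding exp_objective
  proof (rule sum_strict_mono_ex1)
    show "\<forall>f\<in>UNIV. selection_coeff F f * exp (t \<bullet> (expo f - c)) * exp (1 * ((\<Sum>i\<in>I. expo f $ i) - (\<Sum>i\<in>I. c $ i)))
       \<le> selection_coeff F f * exp (t \<bullet> (expo f - c))"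
    proof
      fix f show "selection_coeff F f * exp (t \<bullet> (expo f - c)) * exp (1 * ((\<Sum>i\<in>I. expo f $ i) - (\<Sum>i\<in>I. c $ i)))
         \<le> selection_coeff F f * exp (t \<bullet> (expo f - c))"
        using assms(1)[of f] selection_coeff_nonneg[of F f] by (cases "selection_coeff F f = 0") (auto simp: mult_le_cancel_left1)
    qed
    show "\<exists>f\<in>UNIV. selection_coeff F f * exp (t \<bullet> (expo f - c)) * exp (1 * ((\<Sum>i\<in>I. expo f $ i) - (\<Sum>i\<in>I. c $ i)))
       < selection_coeff F f * exp (t \<bullet> (expo f - c))"
      using assms(2,3) by (intro bexI[of _ g]) (auto simp: mult_less_cancel_left1)
  qed simp
  then show ?thesis by simp
qed

text \<open>Along \<open>indicator_vec I\<close> the objective grows at most linearly, with the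
  slack of the inequality for \<open>I\<close> as slope, so this slack is nonnegative. Along
  \<open>indicator_vec UNIV\<close> it is linear in both directions, which forces equality.\<close>

lemma bounded_below_imp_orbit_polytope:
  assumes "\<And>t. B \<le> objective F c t" "\<And>i. 0 \<le> c $ i"
  shows "c \<in> orbit_polytope F"
proof -
  have nonneg: "0 \<le> q" if "\<And>s. s \<ge> 0 \<Longrightarrow> B \<le> C + s * q" for q C :: real
  proof (rule ccontr)
    assume "\<not> 0 \<le> q"
    then have "B \<le> C + ((\<bar>C - B\<bar> + 1) / - q) * q" by (intro that) (auto simp: divide_nonneg_neg)
    also have "\<dots> = C - (\<bar>C - B\<bar> + 1)" using \<open>\<not> 0 \<le> q\<close> by (simp add: field_simps)
    finally show False by linarith
  qed
  let ?q = "real CARD('d) - (\<Sum>i\<in>UNIV. c $ i)"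
  have total: "objective F c (0 + s *\<^sub>R indicator_vec UNIV) = objective F c 0 + s * ?q" for s
    by (rule objective_shift_eq) (simp add: sum_expo_UNIV)
  have "0 \<le> ?q"
    by (rule nonneg[of "objective F c 0"]) (metis assms(1) total)
  moreover have "0 \<le> - ?q"
    by (rule nonneg[of "objective F c 0"]) (metis assms(1) total minus_mult_commute)
  moreover have "0 \<le> frame_rank F I - (\<Sum>i\<in>I. c $ i)" for I
  proof (rule nonneg[of "objective F c 0"])
    fix s :: real assume "s \<ge> 0"
    show "B \<le> objective F c 0 + s * (frame_rank F I - (\<Sum>i\<in>I. c $ i))"
      by (rule order_trans[OF assms(1) objective_shift_le[of s I]])
        (use \<open>s \<ge> 0\<close> in \<open>auto intro!: mult_left_mono expo_le_rank\<close>)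
  qed
  ultimately show ?thesis using assms(2) by (auto simp: orbit_polytope_def)
qed

section \<open>From a minimiser to the relative interior\<close>

text \<open>If a basis selection fell short of the rank on \<open>I\<close>, translating along
  \<open>indicator_vec I\<close> would go below the minimum. So a selection greedy for
  \<open>- I\<close> attains the rank on both \<open>I\<close> and \<open>- I\<close>; the two ranks
  add up to \<open>CARD('d)\<close> and leave \<open>b\<close> no slack.\<close>

lemma tight_on_orbit_polytope:
  assumes min: "\<And>t'. objective F c t \<le> objective F c t'"
    and tight: "(\<Sum>i\<in>I. c $ i) = frame_rank F I" and b: "b \<in> orbit_polytope F"
  shows "(\<Sum>i\<in>I. b $ i) = frame_rank F I"
proof -
  have split: "(\<Sum>i\<in>I. x $ i) + (\<Sum>i\<in>-I. x $ i) = (\<Sum>i\<in>UNIV. x $ i)" for x :: "real ^ 'n"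
    by (subst sum.union_disjoint[symmetric]) (auto simp: Compl_partition)
  obtain f where f: "selection_coeff F f > 0"
    "(\<Sum>i | 1 \<le> (indicator_vec (- I) :: real ^ 'n) $ i. expo f $ i) =
      frame_rank F {i. 1 \<le> (indicator_vec (- I) :: real ^ 'n) $ i}"
    using greedy_selection[of "indicator_vec (- I)"] by metis
  have "{i. 1 \<le> (indicator_vec (- I) :: real ^ 'n) $ i} = - I" by (auto simp: indicator_vec_def)
  with f(2) have "(\<Sum>i\<in>-I. expo f $ i) = frame_rank F (- I)" by simp
  moreover have "(\<Sum>i\<in>I. expo f $ i) = frame_rank F I"
    using objective_shift_less[of I c f t] min[of "t + indicator_vec I"] expo_le_rank[of F _ I] f(1)
    unfolding tight by (meson not_le order_le_less)
  ultimately have "frame_rank F I + frame_rank F (- I) = real CARD('d)"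
    using split[of "expo f"] sum_expo_UNIV[of f] by simp
  moreover have "(\<Sum>i\<in>I. b $ i) \<le> frame_rank F I" "(\<Sum>i\<in>-I. b $ i) \<le> frame_rank F (- I)"
    "(\<Sum>i\<in>UNIV. b $ i) = real CARD('d)"
    using b by (auto simp only: orbit_polytope_def mem_Collect_eq)
  ultimately show ?thesis using split[of b] by linarith
qed

lemma convex_orbit_polytope: "convex (orbit_polytope F)"
proof (rule convexI)
  fix x y :: "real ^ 'n" and u v :: real
  assume x: "x \<in> orbit_polytope F" and y: "y \<in> orbit_polytope F" and uv: "0 \<le> u" "0 \<le> v" "u + v = 1"
  have sums: "(\<Sum>i\<in>I. (u *\<^sub>R x + v *\<^sub>R y) $ i) = u * (\<Sum>i\<in>I. x $ i) + v * (\<Sum>i\<in>I. y $ i)" for I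
    by (simp add: sum.distrib sum_distrib_left)
  have "u * (\<Sum>i\<in>I. x $ i) + v * (\<Sum>i\<in>I. y $ i) \<le> frame_rank F I" for I
    using x y uv by (intro convex_bound_le) (auto simp only: orbit_polytope_def mem_Collect_eq)
  moreover have "u * real CARD('d) + v * real CARD('d) = real CARD('d)"
    using uv(3) by (simp flip: distrib_right)
  ultimately show "u *\<^sub>R x + v *\<^sub>R y \<in> orbit_polytope F"
    using x y uv unfolding orbit_polytope_def mem_Collect_eq sums by simp
qed

text \<open>Every segment from the polytope to \<open>c\<close> must extend a little beyond
  \<open>c\<close>. Inequalities strict at \<open>c\<close> survive a short extension; rank
  inequalities tight at \<open>c\<close> are equalities along the whole line.\<close>

lemma minimizer_imp_rel_interior:
  assumes min: "\<And>t'. objective F c t \<le> objective F c t'" and pos: "\<And>i. 0 < c $ i"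
  shows "c \<in> rel_interior (orbit_polytope F)"
proof -
  have cK: "c \<in> orbit_polytope F"
    using bounded_below_imp_orbit_polytope[OF min] pos by (simp add: less_imp_le)
  have "\<exists>e>1. (1 - e) *\<^sub>R x + e *\<^sub>R c \<in> orbit_polytope F" if x: "x \<in> orbit_polytope F" for x
  proof -
    have lim: "((\<lambda>e. (1 - e) * a + e * b) \<longlongrightarrow> b) (at_right 1)" for a b :: real
      by (auto intro!: tendsto_eq_intros)
    have sums: "(\<Sum>i\<in>I. ((1 - e) *\<^sub>R x + e *\<^sub>R c) $ i) = (1 - e) * (\<Sum>i\<in>I. x $ i) + e * (\<Sum>i\<in>I. c $ i)" for I e
      by (simp add: sum.distrib sum_distrib_left)
    have "eventually (\<lambda>e. \<forall>i. 0 \<le> ((1 - e) *\<^sub>R x + e *\<^sub>R c) $ i) (at_right 1)"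
    proof (intro eventually_all_finite)
      fix i
      have "eventually (\<lambda>e. 0 < (1 - e) * x $ i + e * c $ i) (at_right 1)"
        by (rule order_tendstoD(1)[OF lim pos])
      then show "eventually (\<lambda>e. 0 \<le> ((1 - e) *\<^sub>R x + e *\<^sub>R c) $ i) (at_right 1)"
        by (rule eventually_mono) simp
    qed
    moreover have "eventually (\<lambda>e. \<forall>I. (\<Sum>i\<in>I. ((1 - e) *\<^sub>R x + e *\<^sub>R c) $ i) \<le> frame_rank F I) (at_right 1)"
    proof (intro eventually_all_finite)
      fix I :: "'n set"
      show "eventually (\<lambda>e. (\<Sum>i\<in>I. ((1 - e) *\<^sub>R x + e *\<^sub>R c) $ i) \<le> frame_rank F I) (at_right 1)"
      proof (cases "(\<Sum>i\<in>I. c $ i) = frame_rank F I")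
        case True
        then show ?thesis unfolding sums using tight_on_orbit_polytope[OF min True x]
          by (simp add: algebra_simps)
      next
        case False
        then have "(\<Sum>i\<in>I. c $ i) < frame_rank F I"
          using cK by (auto simp only: orbit_polytope_def mem_Collect_eq order_le_less)
        then have "eventually (\<lambda>e. (1 - e) * (\<Sum>i\<in>I. x $ i) + e * (\<Sum>i\<in>I. c $ i) < frame_rank F I) (at_right 1)"
          by (rule order_tendstoD(2)[OF lim])
        then show ?thesis unfolding sums by (rule eventually_mono) simp
      qed
    qed
    moreover have "eventually (\<lambda>e. e > (1::real)) (at_right 1)" by (rule eventually_at_right_less)
    ultimately have "eventually (\<lambda>e. e > 1 \<and> (1 - e) *\<^sub>R x + e *\<^sub>R c \<in> orbit_polytope F) (at_right 1)"
    proof eventually_elim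
      case (elim e)
      have "(\<Sum>i\<in>UNIV. ((1 - e) *\<^sub>R x + e *\<^sub>R c) $ i) = real CARD('d)"
        unfolding sums using x cK by (simp add: orbit_polytope_def algebra_simps)
      with elim show ?case by (simp add: orbit_polytope_def del: vector_add_component vector_scaleR_component)
    qed
    then show ?thesis by (auto dest!: eventually_happens'[rotated])
  qed
  then show ?thesis using convex_rel_interior_iff[OF convex_orbit_polytope] cK by blast
qed

end

section \<open>Minimisers and radial isotropic position\<close>

lemma sum_matrix_mult_left: "A ** sum M I = (\<Sum>i\<in>I. A ** M i)"
  for A :: "real ^ 'm::finite ^ 'l::finite" and M :: "'i \<Rightarrow> real ^ 'k::finite ^ 'm"
  by (induction I rule: infinite_finite_induct) (simp_all add: matrix_add_ldistrib)

lemma matrix_add_rdistrib: "(B + C) ** A = B ** A + C ** A"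
  for A :: "real ^ 'k::finite ^ 'm::finite" and B C :: "real ^ 'm ^ 'l::finite"
  by (simp add: matrix_matrix_mult_def vec_eq_iff distrib_right sum.distrib)

lemma sum_matrix_mult_right: "sum M I ** A = (\<Sum>i\<in>I. M i ** A)"
  for A :: "real ^ 'k::finite ^ 'm::finite" and M :: "'i \<Rightarrow> real ^ 'm ^ 'l::finite"
  by (induction I rule: infinite_finite_induct) (simp_all add: matrix_add_rdistrib)

text \<open>Normalising the Gram matrix to the identity thus becomes the isotropy equation for
  \<open>A ** F $ i\<close> with coefficients \<open>exp (t $ i)\<close>.\<close>

lemma congruence_frame_gram:
  "A ** frame_gram F t ** transpose A =
    (\<Sum>i\<in>UNIV. exp (t $ i) *\<^sub>R ((A ** F $ i) ** transpose (A ** F $ i)))"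
  by (simp add: frame_gram_def sum_matrix_mult_left sum_matrix_mult_right matrix_scalar_ac
      scalar_matrix_assoc[symmetric] matrix_transpose_mul matrix_mul_assoc)

lemma frame_gram_shift_axis:
  "frame_gram F (t + s *\<^sub>R axis i 1) =
    frame_gram F t + (exp s - 1) *\<^sub>R (exp (t $ i) *\<^sub>R (F $ i ** transpose (F $ i)))"
proof -
  have "exp ((t + s *\<^sub>R axis i 1) $ j) *\<^sub>R (F $ j ** transpose (F $ j)) =
      exp (t $ j) *\<^sub>R (F $ j ** transpose (F $ j)) +
      (if j = i then (exp s - 1) *\<^sub>R (exp (t $ i) *\<^sub>R (F $ i ** transpose (F $ i))) else 0)" for j
    by (auto simp: axis_def exp_add algebra_simps simp flip: scaleR_add_left)
  then show ?thesis by (simp add: frame_gram_def sum.distrib)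
qed

context frame
begin

section \<open>From the relative interior to a minimiser\<close>

lemma total_shift:
  assumes "(\<Sum>i\<in>UNIV. c $ i) = real CARD('d)"
  shows "objective F c (t + s *\<^sub>R indicator_vec UNIV) = objective F c t"
  using objective_shift_eq[of UNIV c 0 t s] assms by (simp add: sum_expo_UNIV)

lemma continuous_on_objective: "continuous_on S (objective F c)"
proof -
  have "objective F c = (\<lambda>t. ln (\<Sum>f\<in>UNIV. selection_coeff F f * exp (t \<bullet> (expo f - c))))"
    by (simp flip: exp_objective)
  moreover have "(\<Sum>f\<in>UNIV. selection_coeff F f * exp (t \<bullet> (expo f - c))) \<noteq> 0" for t
    by (simp flip: exp_objective)
  ultimately show ?thesis by (auto intro!: continuous_intros)
qed

text \<open>The segment from \<open>expo f\<close> to \<open>c\<close> extends beyond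
  \<open>c\<close> inside the polytope. Were \<open>expo f\<close> below the rank on
  \<open>I\<close>, the extension would exceed it.\<close>

lemma tight_at_rel_interior:
  assumes c: "c \<in> rel_interior (orbit_polytope F)" and tight: "(\<Sum>i\<in>I. c $ i) = frame_rank F I"
    and f: "selection_coeff F f > 0"
  shows "(\<Sum>i\<in>I. expo f $ i) = frame_rank F I"
proof -
  have "orbit_polytope F \<noteq> {}" using c rel_interior_subset by blast
  then obtain e where e: "e > 1" "(1 - e) *\<^sub>R expo f + e *\<^sub>R c \<in> orbit_polytope F"
    using c convex_rel_interior_iff[OF convex_orbit_polytope] expo_in_orbit_polytope[OF f] by blast
  then have "(\<Sum>i\<in>I. ((1 - e) *\<^sub>R expo f + e *\<^sub>R c) $ i) \<le> frame_rank F I"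
    by (simp only: orbit_polytope_def mem_Collect_eq)
  then have "(1 - e) * (\<Sum>i\<in>I. expo f $ i) + e * frame_rank F I \<le> frame_rank F I"
    unfolding tight[symmetric] by (simp add: sum.distrib sum_distrib_left)
  then have "(e - 1) * frame_rank F I \<le> (e - 1) * (\<Sum>i\<in>I. expo f $ i)"
    by (simp add: algebra_simps)
  then show ?thesis using e(1) expo_le_rank[OF f, of I] by simp
qed

text \<open>Among the points with the same value, \<open>u\<close> has the fewest distinct coordinates: a gap of \<open>u\<close> at a
  tight superlevel set could be closed by a translation that merges two values.\<close>

lemma close_tight_gaps:
  fixes c t :: "real ^ 'n"
  assumes inv: "\<And>I t s. (\<Sum>i\<in>I. c $ i) = frame_rank F I \<Longrightarrow>
    objective F c (t + s *\<^sub>R indicator_vec I) = objective F c t"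
  obtains u where "objective F c u = objective F c t"
    "\<And>s. {i. s \<le> u $ i} \<noteq> {} \<Longrightarrow> {i. s \<le> u $ i} \<noteq> UNIV \<Longrightarrow>
      (\<Sum>i | s \<le> u $ i. c $ i) \<noteq> frame_rank F {i. s \<le> u $ i}"
proof -
  let ?N = "\<lambda>u :: real ^ 'n. card (range (($) u))"
  obtain u where u: "objective F c u = objective F c t"
    and least: "\<And>v. objective F c v = objective F c t \<Longrightarrow> ?N u \<le> ?N v"
    using ex_has_least_nat[of "\<lambda>u. objective F c u = objective F c t" t ?N] by auto
  have "(\<Sum>i | s \<le> u $ i. c $ i) \<noteq> frame_rank F {i. s \<le> u $ i}"
    if ne: "{i. s \<le> u $ i} \<noteq> {}" "{i. s \<le> u $ i} \<noteq> UNIV" for s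
  proof
    define I where "I = {i. s \<le> u $ i}"
    assume tight: "(\<Sum>i | s \<le> u $ i. c $ i) = frame_rank F {i. s \<le> u $ i}"
    define m where "m = Min (($) u ` I)"
    define m' where "m' = Max (($) u ` (- I))"
    have m: "m \<in> ($) u ` I" unfolding m_def using ne by (intro Min_in) (auto simp: I_def)
    have m': "m' \<in> ($) u ` (- I)" unfolding m'_def using ne by (intro Max_in) (auto simp: I_def)
    define v where "v = u + (m' - m) *\<^sub>R indicator_vec I"
    have v: "v $ i = (if i \<in> I then u $ i + (m' - m) else u $ i)" for i
      by (simp add: v_def indicator_vec_def)
    let ?B = "(\<lambda>x. x + (m' - m)) ` ($) u ` I" and ?C = "($) u ` (- I)"
    have "range (($) v) = ?B \<union> ?C" by (auto simp: v image_iff)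
    then have "?N v = card (?B \<union> ?C)" by simp
    \<comment> \<open>Both images contain \<open>m'\<close>, so inclusion-exclusion leaves fewer
      distinct values than \<open>u\<close> has.\<close>
    moreover have "m' \<in> ?B \<inter> ?C" using m m' by force
    then have "card (?B \<inter> ?C) > 0" by (subst card_gt_0_iff) auto
    moreover have "card (?B \<union> ?C) + card (?B \<inter> ?C) = card ?B + card ?C"
      by (rule card_Un_Int[symmetric]) auto
    moreover have "card ?B \<le> card (($) u ` I)" by (rule card_image_le) simp
    moreover have "card (range (($) u)) = card (($) u ` I) + card ?C"
    proof (subst card_Un_disjoint[symmetric])
      show "($) u ` I \<inter> ?C = {}" by (auto simp: I_def)
      show "card (range (($) u)) = card (($) u ` I \<union> ?C)" by (simp flip: image_Un)
    qed auto
    ultimately have "?N v < ?N u" by linarith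
    moreover have "objective F c v = objective F c t"
      unfolding v_def using inv[of I] tight u by (simp add: I_def)
    ultimately show False using least[of v] by simp
  qed
  then show thesis using u that by blast
qed

text \<open>A minimum over a compact box is global: any competitor not worse than the origin moves
  into the box at the same value, by closing its tight gaps and then translating all coordinates
  together.\<close>

lemma rel_interior_imp_minimizer:
  assumes c: "c \<in> rel_interior (orbit_polytope F)"
  obtains t where "\<And>t'. objective F c t \<le> objective F c t'"
proof -
  have cK: "c \<in> orbit_polytope F" using c rel_interior_subset by blast
  then have total: "(\<Sum>i\<in>UNIV. c $ i) = real CARD('d)"
    and rank: "\<And>I. (\<Sum>i\<in>I. c $ i) \<le> frame_rank F I" by (auto simp only: orbit_polytope_def mem_Collect_eq)
  have inv: "objective F c (t + s *\<^sub>R indicator_vec I) = objective F c t"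
    if "(\<Sum>i\<in>I. c $ i) = frame_rank F I" for I t s
    using objective_shift_eq[of I c 0 t s] tight_at_rel_interior[OF c that] that by simp
  \<comment> \<open>\<open>\<delta>\<close> becomes the least nonzero slack, capped at
    \<open>1\<close> so that \<open>D\<close> is nonempty even if every set is tight.\<close>
  define D where "D = insert 1 ((\<lambda>I. frame_rank F I - (\<Sum>i\<in>I. c $ i)) ` {I. (\<Sum>i\<in>I. c $ i) \<noteq> frame_rank F I})"
  define \<delta> where "\<delta> = Min D"
  have "\<delta> \<in> D" unfolding \<delta>_def by (intro Min_in) (auto simp: D_def)
  then have \<delta>: "\<delta> > 0" using rank by (auto simp: D_def less_le)
  have gap: "(\<Sum>i\<in>I. c $ i) + \<delta> \<le> frame_rank F I" if "(\<Sum>i\<in>I. c $ i) \<noteq> frame_rank F I" for I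
  proof -
    have "\<delta> \<le> frame_rank F I - (\<Sum>i\<in>I. c $ i)"
      unfolding \<delta>_def by (intro Min_le) (use that in \<open>auto simp: D_def\<close>)
    then show ?thesis by simp
  qed
  \<comment> \<open>With slack \<open>\<delta>\<close> on all proper superlevel sets, a spread above
    \<open>B\<close> forces a value above that at the origin.\<close>
  define B where "B = (objective F c 0 - objective_floor) / \<delta>"
  have "B \<ge> 0" using objective_floor_le[OF cK, of 0] \<delta> by (simp add: B_def)
  define S :: "(real ^ 'n) set" where "S = cbox 0 (\<chi> i. B)"
  have "0 \<in> S" using \<open>B \<ge> 0\<close> by (simp add: S_def mem_box_cart)
  then obtain t where t: "t \<in> S" "\<And>t'. t' \<in> S \<Longrightarrow> objective F c t \<le> objective F c t'"
    using continuous_attains_inf[OF _ _ continuous_on_objective, of S c] by (auto simp: S_def)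
  have "objective F c t \<le> objective F c t'" for t'
  proof (cases "objective F c t' \<le> objective F c 0")
    case False
    then show ?thesis using t(2)[OF \<open>0 \<in> S\<close>] by linarith
  next
    case True
    obtain u where u: "objective F c u = objective F c t'"
      "\<And>s. {i. s \<le> u $ i} \<noteq> {} \<Longrightarrow> {i. s \<le> u $ i} \<noteq> UNIV \<Longrightarrow>
        (\<Sum>i | s \<le> u $ i. c $ i) \<noteq> frame_rank F {i. s \<le> u $ i}"
      using close_tight_gaps[OF inv] by blast
    have bound: "u $ i - u $ j \<le> B" for i j
    proof -
      have "objective_floor + \<delta> * (u $ i - u $ j) \<le> objective F c u"
        using \<delta> u(2) gap by (intro objective_lower_bound total) auto
      then show ?thesis using u(1) True \<delta> by (simp add: B_def field_simps)
    qed
    define m where "m = Min (range (($) u))"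
    have "m \<in> range (($) u)" "\<And>i. m \<le> u $ i" by (auto simp: m_def)
    then have "u + (- m) *\<^sub>R indicator_vec UNIV \<in> S"
      using bound by (auto simp: S_def mem_box_cart indicator_vec_def)
    from t(2)[OF this] show ?thesis by (simp only: total_shift[OF total] u(1))
  qed
  then show thesis by (rule that)
qed

section \<open>First-order conditions and radial isotropy\<close>

text \<open>Both sides are the partial derivative of \<open>det (frame_gram F t)\<close> in
  coordinate \<open>i\<close>: term by term on the left, by Jacobi's formula after congruence to the
  identity on the right.\<close>

lemma weighted_expo_sum:
  fixes A :: "real ^ 'd ^ 'd"
  assumes A: "A ** frame_gram F t ** transpose A = mat 1"
  shows "(\<Sum>f\<in>UNIV. selection_coeff F f * exp (t \<bullet> expo f) * expo f $ i) =
    det (frame_gram F t) * (exp (t $ i) * (norm (A ** F $ i))\<^sup>2)"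
proof -
  define P where "P = exp (t $ i) *\<^sub>R ((A ** F $ i) ** transpose (A ** F $ i))"
  have det_A: "det A * det (frame_gram F t) * det A = 1"
    using arg_cong[OF A, of det] by (simp add: det_mul det_transpose)
  have "A ** frame_gram F (t + s *\<^sub>R axis i 1) ** transpose A = mat 1 + (exp s - 1) *\<^sub>R P" for s
    unfolding frame_gram_shift_axis P_def
    by (simp add: matrix_add_ldistrib matrix_add_rdistrib A matrix_scalar_ac
      scalar_matrix_assoc[symmetric] matrix_transpose_mul matrix_mul_assoc)
  then have det_shift: "det A * det (frame_gram F (t + s *\<^sub>R axis i 1)) * det A = det (mat 1 + (exp s - 1) *\<^sub>R P)" for s
    by (metis det_mul det_transpose)
  have det_eq: "det (frame_gram F (t + s *\<^sub>R axis i 1)) = det (frame_gram F t) * det (mat 1 + (exp s - 1) *\<^sub>R P)" for s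
  proof -
    have "det (frame_gram F (t + s *\<^sub>R axis i 1)) =
        (det A * det (frame_gram F t) * det A) * det (frame_gram F (t + s *\<^sub>R axis i 1))"
      by (simp only: det_A mult_1)
    also have "\<dots> = det (frame_gram F t) * (det A * det (frame_gram F (t + s *\<^sub>R axis i 1)) * det A)"
      by (simp only: mult_ac)
    finally show ?thesis by (simp only: det_shift)
  qed
  have "((\<lambda>s. exp s - 1) has_real_derivative 1) (at 0)" by (auto intro!: derivative_eq_intros)
  \<comment> \<open>The base point is written \<open>exp 0 - 1\<close> to fit the chain rule with
    inner function \<open>exp s - 1\<close>.\<close>
  moreover have "((\<lambda>s. det (mat 1 + s *\<^sub>R P)) has_real_derivative trace P) (at (exp 0 - 1))"
    using has_derivative_det_perturbation[of P] by simp
  ultimately have "((\<lambda>s. det (mat 1 + (exp s - 1) *\<^sub>R P)) has_real_derivative trace P * 1) (at 0)"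
    by (rule DERIV_chain2[rotated])
  then have deriv1: "((\<lambda>s. det (frame_gram F (t + s *\<^sub>R axis i 1))) has_real_derivative det (frame_gram F t) * trace P) (at 0)"
    unfolding det_eq by (auto intro: DERIV_cmult)
  have deriv2: "((\<lambda>s. det (frame_gram F (t + s *\<^sub>R axis i 1))) has_real_derivative
      (\<Sum>f\<in>UNIV. selection_coeff F f * exp (t \<bullet> expo f) * expo f $ i)) (at 0)"
  proof -
    have "((\<lambda>s. \<Sum>f\<in>UNIV. selection_coeff F f * exp (t \<bullet> expo f + s * expo f $ i)) has_real_derivative
        (\<Sum>f\<in>UNIV. selection_coeff F f * exp (t \<bullet> expo f) * expo f $ i)) (at 0)"
      by (auto intro!: derivative_eq_intros simp: mult_ac)
    then show ?thesis by (simp add: det_frame_gram inner_add_left inner_axis')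
  qed
  have "trace P = exp (t $ i) * (norm (A ** F $ i))\<^sup>2"
    by (simp add: P_def trace_mult_transpose[symmetric] trace_def sum_distrib_left)
  then show ?thesis using DERIV_unique[OF deriv2 deriv1] by simp
qed

lemma objective_has_derivative:
  fixes A :: "real ^ 'd ^ 'd"
  assumes A: "A ** frame_gram F t ** transpose A = mat 1"
  shows "((\<lambda>s. objective F c (t + s *\<^sub>R axis i 1)) has_real_derivative
    exp (t $ i) * (norm (A ** F $ i))\<^sup>2 - c $ i) (at 0)"
proof -
  have pos: "(\<Sum>f\<in>UNIV. selection_coeff F f * exp (t \<bullet> expo f)) > 0"
    using det_frame_gram_pos[of t] by (simp add: det_frame_gram)
  have "((\<lambda>s. ln (\<Sum>f\<in>UNIV. selection_coeff F f * exp (t \<bullet> expo f + s * expo f $ i)) - (t \<bullet> c + s * c $ i)) has_real_derivative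
      (\<Sum>f\<in>UNIV. selection_coeff F f * exp (t \<bullet> expo f) * expo f $ i) / (\<Sum>f\<in>UNIV. selection_coeff F f * exp (t \<bullet> expo f)) - c $ i) (at 0)"
    using pos by (auto intro!: derivative_eq_intros simp: mult_ac divide_inverse)
  moreover have "objective F c (t + s *\<^sub>R axis i 1) =
      ln (\<Sum>f\<in>UNIV. selection_coeff F f * exp (t \<bullet> expo f + s * expo f $ i)) - (t \<bullet> c + s * c $ i)" for s
    by (simp add: objective_def Phi_eq det_frame_gram inner_add_left inner_axis')
  ultimately show ?thesis
    using pos unfolding weighted_expo_sum[OF A] det_frame_gram by simp
qed

text \<open>At a critical point \<open>exp (t $ i)\<close> equals the isotropy coefficient of
  \<open>A ** F $ i\<close>, where \<open>A\<close> normalises the Gram matrix. Positive weights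
  keep these matrices nonzero.\<close>

lemma minimizer_imp_RIF:
  assumes min: "\<And>t'. objective F c t \<le> objective F c t'" and pos: "\<And>i. 0 < c $ i"
  shows "transformable_to_RIF F c"
proof -
  obtain A :: "real ^ 'd ^ 'd" where A: "A ** frame_gram F t ** transpose A = mat 1"
    using congruent_to_identity[OF frame_gram_pd] by blast
  have crit: "exp (t $ i) * (norm (A ** F $ i))\<^sup>2 = c $ i" for i
    using DERIV_local_min[OF objective_has_derivative[OF A, of c i], of 1] min by simp
  have nz: "A ** F $ i \<noteq> 0" for i using crit[of i] pos[of i] by auto
  have "c $ i / (norm (A ** F $ i))\<^sup>2 = exp (t $ i)" for i
    using nz[of i] by (simp add: crit[symmetric])
  then have "radial_isotropic (\<chi> i. A ** F $ i) c"
    using A nz by (simp add: radial_isotropic_def congruence_frame_gram)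
  moreover have "invertible A"
    using A by (metis invertible_right_inverse matrix_mul_assoc)
  ultimately show ?thesis by (auto simp: transformable_to_RIF_def)
qed

text \<open>With the isotropy coefficients as \<open>exp (t $ i)\<close> the gradient vanishes, so
  the terms balance; convexity in the form \<open>1 + x \<le> exp x\<close> then gives global
  minimality.\<close>

lemma RIF_imp_minimizer:
  assumes "transformable_to_RIF F c" and pos: "\<And>i. 0 < c $ i"
  obtains t where "\<And>t'. objective F c t \<le> objective F c t'"
proof -
  obtain A :: "real ^ 'd ^ 'd" where nz: "\<And>i. A ** F $ i \<noteq> 0"
    and sum: "(\<Sum>i\<in>UNIV. (c $ i / (norm (A ** F $ i))\<^sup>2) *\<^sub>R ((A ** F $ i) ** transpose (A ** F $ i))) = mat 1"
    using assms(1) by (auto simp: transformable_to_RIF_def radial_isotropic_def)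
  define t :: "real ^ 'n" where "t = (\<chi> i. ln (c $ i / (norm (A ** F $ i))\<^sup>2))"
  have exp_t: "exp (t $ i) = c $ i / (norm (A ** F $ i))\<^sup>2" for i
    using pos[of i] nz[of i] by (simp add: t_def)
  have A: "A ** frame_gram F t ** transpose A = mat 1"
    by (simp add: congruence_frame_gram exp_t sum)
  let ?v = "\<lambda>f. selection_coeff F f * exp (t \<bullet> (expo f - c))"
  have v: "?v f = selection_coeff F f * exp (t \<bullet> expo f) * exp (- (t \<bullet> c))" for f
    by (simp add: inner_diff_right exp_diff exp_minus field_simps)
  have "(\<Sum>f\<in>UNIV. ?v f * (expo f - c) $ i) = 0" for i
  proof -
    have "(\<Sum>f\<in>UNIV. ?v f * (expo f - c) $ i) =
        ((\<Sum>f\<in>UNIV. selection_coeff F f * exp (t \<bullet> expo f) * expo f $ i) -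
         det (frame_gram F t) * c $ i) * exp (- (t \<bullet> c))"
      unfolding v det_frame_gram
      by (simp add: sum_distrib_right sum_distrib_left sum_subtractf[symmetric] algebra_simps)
    also have "\<dots> = 0" using nz[of i] by (simp add: weighted_expo_sum[OF A] exp_t)
    finally show ?thesis .
  qed
  then have "(\<Sum>f\<in>UNIV. ?v f *\<^sub>R (expo f - c)) = 0" by (simp add: vec_eq_iff)
  then have balance: "(\<Sum>f\<in>UNIV. ?v f * (u \<bullet> (expo f - c))) = 0" for u
    using inner_sum_right[of u "\<lambda>f. ?v f *\<^sub>R (expo f - c)" UNIV] by simp
  have "objective F c t \<le> objective F c t'" for t'
  proof -
    have "exp (objective F c t) = (\<Sum>f\<in>UNIV. ?v f * (1 + (t' - t) \<bullet> (expo f - c)))"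
      by (simp only: exp_objective distrib_left sum.distrib balance) simp
    also have "\<dots> \<le> (\<Sum>f\<in>UNIV. ?v f * exp ((t' - t) \<bullet> (expo f - c)))"
      by (intro sum_mono mult_left_mono exp_ge_add_one_self) (simp add: selection_coeff_nonneg)
    also have "\<dots> = exp (objective F c t')"
      by (simp add: exp_objective inner_diff_left mult.assoc flip: exp_add)
    finally show ?thesis by simp
  qed
  then show thesis by (rule that)
qed

text \<open>A minimiser \<open>t\<close> of the objective plus \<open>\<epsilon> \<parallel>t\<parallel>\<^sup>2\<close> has gradient \<open>-2 \<epsilon> t\<close>, and \<open>\<epsilon> \<parallel>t\<parallel>\<^sup>2\<close> is bounded
  independently of \<open>\<epsilon>\<close>.\<close>

lemma nearly_critical_point:
  assumes c: "c \<in> orbit_polytope F" and "\<eta> > 0"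
  obtains t and A :: "real ^ 'd ^ 'd" where "A ** frame_gram F t ** transpose A = mat 1"
    "\<And>i. \<bar>exp (t $ i) * (norm (A ** F $ i))\<^sup>2 - c $ i\<bar> \<le> \<eta>"
proof -
  define C where "C = objective F c 0 - objective_floor"
  have "C \<ge> 0" using objective_floor_le[OF c, of 0] by (simp add: C_def)
  \<comment> \<open>Chosen so that \<open>4 * \<epsilon> * C \<le> \<eta>\<^sup>2\<close>; adding
    \<open>1\<close> avoids division by zero.\<close>
  define \<epsilon> where "\<epsilon> = \<eta>\<^sup>2 / (4 * (C + 1))"
  have \<epsilon>: "\<epsilon> > 0" using \<open>\<eta> > 0\<close> \<open>C \<ge> 0\<close> by (simp add: \<epsilon>_def)
  have \<epsilon>C: "4 * \<epsilon> * C \<le> \<eta>\<^sup>2" using \<open>\<eta> > 0\<close> \<open>C \<ge> 0\<close> by (simp add: \<epsilon>_def field_simps)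
  let ?g = "\<lambda>t. objective F c t + \<epsilon> * (t \<bullet> t)"
  \<comment> \<open>Outside this ball the penalty alone exceeds \<open>C\<close>, so the value is
    above that at the origin.\<close>
  define R where "R = sqrt (C / \<epsilon>)"
  have "R \<ge> 0" using \<epsilon> \<open>C \<ge> 0\<close> by (simp add: R_def)
  have "continuous_on (cball 0 R) ?g" by (intro continuous_intros continuous_on_objective)
  then obtain t where t: "t \<in> cball 0 R" "\<And>t'. t' \<in> cball 0 R \<Longrightarrow> ?g t \<le> ?g t'"
    using continuous_attains_inf[of "cball 0 R" ?g] \<open>R \<ge> 0\<close> by auto
  have g0: "?g t \<le> objective F c 0" using t(2)[of 0] \<open>R \<ge> 0\<close> by simp
  have min: "?g t \<le> ?g t'" for t'
  proof (cases "t' \<in> cball 0 R")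
    case False
    then have "R < norm t'" by simp
    then have "R\<^sup>2 < (norm t')\<^sup>2" using \<open>R \<ge> 0\<close> by (intro power_strict_mono) auto
    then have "C / \<epsilon> < t' \<bullet> t'" using \<epsilon> \<open>C \<ge> 0\<close> by (simp add: R_def power2_norm_eq_inner)
    then have "C < \<epsilon> * (t' \<bullet> t')" using \<epsilon> by (simp add: field_simps)
    then show ?thesis using g0 objective_floor_le[OF c, of t'] by (simp add: C_def)
  qed (rule t(2))
  obtain A :: "real ^ 'd ^ 'd" where A: "A ** frame_gram F t ** transpose A = mat 1"
    using congruent_to_identity[OF frame_gram_pd] by blast
  have "\<bar>exp (t $ i) * (norm (A ** F $ i))\<^sup>2 - c $ i\<bar> \<le> \<eta>" for i
  proof -
    have "((\<lambda>s. (t + s *\<^sub>R axis i 1) \<bullet> (t + s *\<^sub>R axis i 1)) has_real_derivative 2 * t $ i) (at 0)"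
    proof -
      have "(t + s *\<^sub>R axis i 1) \<bullet> (t + s *\<^sub>R axis i 1) = t \<bullet> t + 2 * s * t $ i + s\<^sup>2" for s
        by (simp add: inner_add_left inner_add_right inner_axis inner_axis' power2_eq_square algebra_simps)
      then show ?thesis by (auto intro!: derivative_eq_intros)
    qed
    then have "((\<lambda>s. ?g (t + s *\<^sub>R axis i 1)) has_real_derivative
        exp (t $ i) * (norm (A ** F $ i))\<^sup>2 - c $ i + \<epsilon> * (2 * t $ i)) (at 0)"
      by (intro DERIV_add objective_has_derivative[OF A] DERIV_cmult)
    then have crit: "exp (t $ i) * (norm (A ** F $ i))\<^sup>2 - c $ i = - (2 * \<epsilon> * t $ i)"
      using DERIV_local_min[of "\<lambda>s. ?g (t + s *\<^sub>R axis i 1)" _ 0 1] min by force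
    have "\<epsilon> * (t \<bullet> t) \<le> C"
      using g0 objective_floor_le[OF c, of t] by (simp add: C_def)
    moreover have "(t $ i)\<^sup>2 \<le> t \<bullet> t"
      using component_le_norm_cart[of t i] by (metis abs_le_square_iff abs_norm_cancel power2_norm_eq_inner)
    ultimately have "\<epsilon> * (t $ i)\<^sup>2 \<le> C"
      using \<epsilon> by (meson less_imp_le mult_left_mono order_trans)
    then have "4 * \<epsilon> * (\<epsilon> * (t $ i)\<^sup>2) \<le> 4 * \<epsilon> * C" using \<epsilon> by simp
    with \<epsilon>C have "(2 * \<epsilon> * t $ i)\<^sup>2 \<le> \<eta>\<^sup>2" by (simp add: power2_eq_square mult_ac)
    then have "\<bar>2 * \<epsilon> * t $ i\<bar> \<le> \<eta>" using \<open>\<eta> > 0\<close> by (simp flip: abs_le_square_iff)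
    then show ?thesis by (simp add: crit)
  qed
  with A show thesis by (rule that)
qed

section \<open>Finiteness and attainment of the infimum\<close>

text \<open>The value at the origin keeps the infimum below \<open>\<infinity>\<close>, so only a
  lower bound is at stake.\<close>

lemma f_frame_finite_iff: "\<bar>f_frame F c\<bar> \<noteq> \<infinity> \<longleftrightarrow> (\<exists>B. \<forall>t. B \<le> objective F c t)"
proof
  assume "\<bar>f_frame F c\<bar> \<noteq> \<infinity>"
  then obtain B where B: "f_frame F c = ereal B" by (cases "f_frame F c") auto
  have "B \<le> objective F c t" for t
    using INF_lower[of t UNIV "\<lambda>t. ereal (objective F c t)"] B by (simp add: f_frame_def objective_def)
  then show "\<exists>B. \<forall>t. B \<le> objective F c t" by blast
next
  assume "\<exists>B. \<forall>t. B \<le> objective F c t"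
  then obtain B where "\<And>t. B \<le> objective F c t" by blast
  then have "ereal B \<le> f_frame F c"
    by (auto simp: f_frame_def objective_def intro!: INF_greatest)
  moreover have "f_frame F c \<le> ereal (objective F c 0)"
    by (auto simp: f_frame_def objective_def intro!: INF_lower2[of 0])
  ultimately show "\<bar>f_frame F c\<bar> \<noteq> \<infinity>" by auto
qed

lemma f_frame_attained_iff:
  "f_frame F c = ereal (Phi F t - t \<bullet> c) \<longleftrightarrow> (\<forall>t'. objective F c t \<le> objective F c t')"
proof
  assume *: "f_frame F c = ereal (Phi F t - t \<bullet> c)"
  show "\<forall>t'. objective F c t \<le> objective F c t'"
    using INF_lower[of _ UNIV "\<lambda>t. ereal (objective F c t)"] * by (simp add: f_frame_def objective_def)
next
  assume "\<forall>t'. objective F c t \<le> objective F c t'"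
  then show "f_frame F c = ereal (Phi F t - t \<bullet> c)"
    unfolding f_frame_def objective_def by (intro antisym INF_lower INF_greatest) auto
qed

lemma orbit_polytope_iff_finite:
  assumes "\<And>i. 0 \<le> c $ i"
  shows "c \<in> orbit_polytope F \<longleftrightarrow> \<bar>f_frame F c\<bar> \<noteq> \<infinity>"
  unfolding f_frame_finite_iff
  using bounded_below_imp_orbit_polytope[OF _ assms] objective_floor_le by blast

end

section \<open>Degeneration to a radial isotropic frame\<close>

lemma transpose_scaleR: "transpose (a *\<^sub>R X) = a *\<^sub>R transpose X"
  for X :: "real ^ 'm::finite ^ 'l::finite"
  by (simp add: vec_eq_iff transpose_def)

text \<open>The action multiplies transposed matrices on the right by an inverse, so the group
  element at vertex \<open>0\<close> is the inverse of \<open>transpose A\<close>.\<close>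

lemma frame_coords_in_orbit:
  fixes A :: "real ^ 'd::finite ^ 'd"
  assumes "invertible A" "\<And>i. \<mu> $ i \<noteq> 0"
  shows "frame_coords (\<chi> i. \<mu> $ i *\<^sub>R (A ** F $ i)) \<in> rep_orbit (frame_coords F)"
proof -
  have "invertible (transpose A)"
    using assms(1) by (simp add: invertible_det_nz det_transpose)
  then obtain B where B: "transpose A ** B = mat 1" "B ** transpose A = mat 1"
    by (auto simp: invertible_def)
  then have "invertible B" by (auto simp: invertible_def)
  then have "B ** matrix_inv B = mat 1"
    unfolding invertible_def matrix_inv_def by (metis (mono_tags, lifting) someI_ex)
  then have inv: "matrix_inv B = transpose A"
    using matrix_mul_assoc[of "transpose A" B "matrix_inv B"] B(1) by simp
  have "frame_coords (\<chi> i. \<mu> $ i *\<^sub>R (A ** F $ i)) = rep_action B \<mu> (frame_coords F)"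
    by (simp add: frame_coords_def rep_action_def inv transpose_scaleR matrix_transpose_mul)
  then show ?thesis unfolding rep_orbit_def using \<open>invertible B\<close> assms(2) by blast
qed

lemma tendsto_frame_coords:
  assumes "Y \<longlonglongrightarrow> Y'"
  shows "(\<lambda>k. frame_coords (Y k)) \<longlonglongrightarrow> frame_coords Y'"
  unfolding frame_coords_def transpose_def
  by (intro tendsto_vec_lambda tendsto_vec_nth assms)

lemma tendsto_mult_transpose:
  fixes X :: "nat \<Rightarrow> real ^ 'k::finite ^ 'd::finite"
  assumes "X \<longlonglongrightarrow> X'"
  shows "(\<lambda>k. X k ** transpose (X k)) \<longlonglongrightarrow> X' ** transpose X'"
  unfolding matrix_matrix_mult_def transpose_def
  by (auto intro!: tendsto_vec_lambda tendsto_sum tendsto_mult tendsto_vec_nth assms)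

text \<open>Nearly critical points give frames in the orbit with Gram matrix the identity and
  squared norms tending to \<open>c\<close>. They are bounded; in a limit the squared norms are
  \<open>c $ i > 0\<close>, so no matrix vanishes and all isotropy coefficients are
  \<open>1\<close>.\<close>

lemma (in frame) degenerates_to_RIF:
  assumes "has_columns J F" "c \<in> orbit_polytope F" and pos: "\<And>i. 0 < c $ i"
  obtains Y where "has_columns J Y" "degenerates_to F Y" "radial_isotropic Y c"
    "(\<Sum>i\<in>UNIV. Y $ i ** transpose (Y $ i)) = mat 1"
proof -
  have "\<exists>t (A :: real ^ 'd ^ 'd). A ** frame_gram F t ** transpose A = mat 1 \<and>
      (\<forall>i. \<bar>exp (t $ i) * (norm (A ** F $ i))\<^sup>2 - c $ i\<bar> \<le> inverse (real (Suc k)))" for k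
    by (rule nearly_critical_point[OF assms(2), of "inverse (real (Suc k))"]) (simp, blast)
  then obtain t and A :: "nat \<Rightarrow> real ^ 'd ^ 'd" where
    A: "\<And>k. A k ** frame_gram F (t k) ** transpose (A k) = mat 1" and
    near: "\<And>k i. \<bar>exp (t k $ i) * (norm (A k ** F $ i))\<^sup>2 - c $ i\<bar> \<le> inverse (real (Suc k))"
    by metis
  \<comment> \<open>The exponent is halved because the Gram product squares the factor.\<close>
  define Y where "Y k = (\<chi> i. exp (t k $ i / 2) *\<^sub>R (A k ** F $ i))" for k
  have exp_half: "exp (x / 2) * exp (x / 2) = exp x" for x :: real by (simp flip: exp_add)
  have norm_Y: "(norm (Y k $ i))\<^sup>2 = exp (t k $ i) * (norm (A k ** F $ i))\<^sup>2" for k i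
    by (simp add: Y_def power_mult_distrib power2_eq_square exp_half)
  have sum_Y: "(\<Sum>i\<in>UNIV. Y k $ i ** transpose (Y k $ i)) = mat 1" for k
  proof -
    have "Y k $ i ** transpose (Y k $ i) = exp (t k $ i) *\<^sub>R ((A k ** F $ i) ** transpose (A k ** F $ i))" for i
      by (simp add: Y_def transpose_scaleR matrix_scalar_ac scalar_matrix_assoc[symmetric] exp_half)
    then show ?thesis using A[of k] by (simp add: congruence_frame_gram)
  qed

  have "bounded (range Y)"
  proof (rule boundedI)
    fix y assume "y \<in> range Y"
    then obtain k where y: "y = Y k" by blast
    have "norm (Y k $ i) \<le> c $ i + 1" for i
    proof (rule power2_le_imp_le)
      have "inverse (real (Suc k)) \<le> 1" by (simp add: field_simps)
      then have "(norm (Y k $ i))\<^sup>2 \<le> c $ i + 1" using near[of k i] unfolding norm_Y by linarith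
      also have "\<dots> \<le> (c $ i + 1)\<^sup>2" using pos[of i] by (simp add: power2_eq_square algebra_simps)
      finally show "(norm (Y k $ i))\<^sup>2 \<le> (c $ i + 1)\<^sup>2" .
    qed (use pos[of i] in simp)
    then have "(\<Sum>i\<in>UNIV. norm (Y k $ i)) \<le> (\<Sum>i\<in>UNIV. c $ i + 1)" by (rule sum_mono)
    moreover have "norm (Y k) \<le> (\<Sum>i\<in>UNIV. norm (Y k $ i))"
      unfolding norm_vec_def[of "Y k"] by (rule L2_set_le_sum) simp
    ultimately show "norm y \<le> (\<Sum>i\<in>UNIV. c $ i + 1)" unfolding y by linarith
  qed
  then obtain Y' r where r: "strict_mono (r :: nat \<Rightarrow> nat)" and lim: "(\<lambda>k. Y (r k)) \<longlonglongrightarrow> Y'"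
    using bounded_imp_convergent_subsequence[of Y] by (auto simp: comp_def)
  have lim_i: "(\<lambda>k. Y (r k) $ i) \<longlonglongrightarrow> Y' $ i" for i
    by (rule tendsto_vec_nth[OF lim])
  have norm_Y': "(norm (Y' $ i))\<^sup>2 = c $ i" for i
  proof (rule LIMSEQ_unique)
    show "(\<lambda>k. (norm (Y (r k) $ i))\<^sup>2) \<longlonglongrightarrow> (norm (Y' $ i))\<^sup>2"
      by (intro tendsto_intros lim_i)
    have "(\<lambda>k. (norm (Y k $ i))\<^sup>2 - c $ i) \<longlonglongrightarrow> 0"
      by (rule Lim_null_comparison[OF _ LIMSEQ_inverse_real_of_nat]) (use near[of _ i] in \<open>simp add: norm_Y\<close>)
    then have "(\<lambda>k. (norm (Y k $ i))\<^sup>2) \<longlonglongrightarrow> c $ i" by (simp add: LIM_zero_iff)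
    then show "(\<lambda>k. (norm (Y (r k) $ i))\<^sup>2) \<longlonglongrightarrow> c $ i"
      using LIMSEQ_subseq_LIMSEQ[OF _ r] by (auto simp: comp_def)
  qed
  have sum_Y': "(\<Sum>i\<in>UNIV. Y' $ i ** transpose (Y' $ i)) = mat 1"
  proof (rule LIMSEQ_unique)
    show "(\<lambda>k. \<Sum>i\<in>UNIV. Y (r k) $ i ** transpose (Y (r k) $ i)) \<longlonglongrightarrow> (\<Sum>i\<in>UNIV. Y' $ i ** transpose (Y' $ i))"
      by (intro tendsto_sum tendsto_mult_transpose lim_i)
    show "(\<lambda>k. \<Sum>i\<in>UNIV. Y (r k) $ i ** transpose (Y (r k) $ i)) \<longlonglongrightarrow> mat 1"
      unfolding sum_Y by simp
  qed
  have nz: "Y' $ i \<noteq> 0" for i using norm_Y'[of i] pos[of i] by auto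
  show thesis
  proof (rule that)
    show "radial_isotropic Y' c"
      using nz pos sum_Y' by (simp add: radial_isotropic_def norm_Y' less_imp_neq[symmetric])
    show "has_columns J Y'"
      unfolding has_columns_def
    proof (intro allI impI)
      fix i l assume "l \<notin> J i"
      then have F0: "F $ i $ a $ l = 0" for a
        using assms(1) by (auto simp: has_columns_def column_def vec_eq_iff)
      have "Y' $ i $ a $ l = 0" for a
      proof (rule LIMSEQ_unique)
        show "(\<lambda>k. Y (r k) $ i $ a $ l) \<longlonglongrightarrow> Y' $ i $ a $ l"
          by (intro tendsto_vec_nth lim_i)
        show "(\<lambda>k. Y (r k) $ i $ a $ l) \<longlonglongrightarrow> 0"
          by (simp add: Y_def matrix_matrix_mult_def F0)
      qed
      then show "column l (Y' $ i) = 0" by (simp add: column_def vec_eq_iff)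
    qed
    have "frame_coords (Y k) \<in> rep_orbit (frame_coords F)" for k
    proof -
      have "invertible (A k)" using A[of k] by (metis invertible_right_inverse matrix_mul_assoc)
      then show ?thesis
        using frame_coords_in_orbit[of "A k" "\<chi> i. exp (t k $ i / 2)" F] by (simp add: Y_def)
    qed
    then show "degenerates_to F Y'"
      unfolding degenerates_to_def closure_sequential
      by (intro exI[of _ "\<lambda>k. frame_coords (Y (r k))"] conjI allI tendsto_frame_coords[OF lim])
  qed (fact sum_Y')
qed

section \<open>Domain of the infimum, degeneration, and attainment\<close>

theorem theorem1:
  fixes J :: "'n::finite \<Rightarrow> 'k::finite set"
    and F :: "('d::finite, 'k, 'n) matrix_tuple"
    and c :: "real ^ 'n"
  assumes "CARD('n) > CARD('d)"
    and "\<And>i. J i \<noteq> {}"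
    and "matrix_frame J F"
    and "c \<in> pos_rat_vectors"
    and "(\<Sum>i\<in>UNIV. c $ i) = real CARD('d)"
  shows
    "{b \<in> pos_rat_vectors. \<bar>f_frame F b\<bar> \<noteq> \<infinity>} = orbit_polytope F \<inter> pos_rat_vectors
     \<and> (semi_stable_frame J F c \<longrightarrow>
          (\<exists>F'. semi_stable_frame J F' c \<and> degenerates_to F F' \<and> transformable_to_RIF F' c))
     \<and> (locally_semi_simple (frame_quiver J) (V_frame F) \<longrightarrow>
          (c \<in> rel_interior (orbit_polytope F) \<longleftrightarrow> transformable_to_RIF F c) \<and>
          (transformable_to_RIF F c \<longleftrightarrow>
             \<bar>f_frame F c\<bar> \<noteq> \<infinity> \<and> (\<exists>t. f_frame F c = ereal (Phi F t - t \<bullet> c))))"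
proof -
  interpret frame F using assms(3) by unfold_locales (simp add: matrix_frame_def)
  have nonneg: "0 \<le> b $ i" if "b \<in> pos_rat_vectors" for b :: "real ^ 'n" and i
    using that by (simp add: pos_rat_vectors_def less_imp_le)
  have pos: "0 < c $ i" for i using assms(4) by (simp add: pos_rat_vectors_def)
  have part1: "{b \<in> pos_rat_vectors. \<bar>f_frame F b\<bar> \<noteq> \<infinity>} = orbit_polytope F \<inter> pos_rat_vectors"
    by (auto simp: orbit_polytope_iff_finite nonneg)
  have part2: "\<exists>F'. semi_stable_frame J F' c \<and> degenerates_to F F' \<and> transformable_to_RIF F' c"
    if "semi_stable_frame J F c"
  proof -
    have "has_columns J F" "c \<in> orbit_polytope F"
      using that by (auto simp: semi_stable_frame_def matrix_frame_def)
    then obtain Y where Y: "has_columns J Y" "degenerates_to F Y" "radial_isotropic Y c"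
      "(\<Sum>i\<in>UNIV. Y $ i ** transpose (Y $ i)) = mat 1"
      using degenerates_to_RIF[OF _ _ pos] by blast
    have frame_Y: "matrix_frame J Y"
      using Y(1,4) by (simp add: matrix_frame_def positive_definite_def transpose_mat)
    then interpret Y: frame Y by unfold_locales (simp add: matrix_frame_def)
    have "(\<chi> i. mat 1 ** Y $ i) = Y" by (simp add: vec_eq_iff)
    then have RIF: "transformable_to_RIF Y c"
      unfolding transformable_to_RIF_def
      using Y(3) by (intro exI[of _ "mat 1"]) (simp add: invertible_det_nz)
    \<comment> \<open>Radial isotropy yields a minimiser, whose value bounds the objective from
      below and so places \<open>c\<close> in the polytope of \<open>Y\<close>.\<close>
    then obtain t where "\<And>t'. objective Y c t \<le> objective Y c t'"
      using Y.RIF_imp_minimizer pos by blast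
    then have "c \<in> orbit_polytope Y"
      by (rule Y.bounded_below_imp_orbit_polytope) (simp add: pos less_imp_le)
    with frame_Y Y(2) RIF assms(4) show ?thesis by (auto simp: semi_stable_frame_def)
  qed
  \<comment> \<open>All three conditions are compared with the existence of a minimiser.\<close>
  have rel_interior_iff: "c \<in> rel_interior (orbit_polytope F) \<longleftrightarrow> (\<exists>t. \<forall>t'. objective F c t \<le> objective F c t')"
    using rel_interior_imp_minimizer minimizer_imp_rel_interior[OF _ pos] by metis
  have RIF_iff: "transformable_to_RIF F c \<longleftrightarrow> (\<exists>t. \<forall>t'. objective F c t \<le> objective F c t')"
    using RIF_imp_minimizer[OF _ pos] minimizer_imp_RIF[OF _ pos] by metis
  have attained_iff: "\<bar>f_frame F c\<bar> \<noteq> \<infinity> \<and> (\<exists>t. f_frame F c = ereal (Phi F t - t \<bullet> c)) \<longleftrightarrow>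
      (\<exists>t. \<forall>t'. objective F c t \<le> objective F c t')"
    unfolding f_frame_attained_iff f_frame_finite_iff by blast
  show ?thesis
    by (intro conjI impI part1 part2) (assumption | simp only: rel_interior_iff RIF_iff attained_iff)+
qed

end
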